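(* Let $B_1,B_2$ be Banach spaces and let $\mathbb X$ (resp. $\mathbb Y$) be a $B_1$-valued (resp. $B_2$-valued) process such that $(\mathbb X,\mathbb Y)$ admits a scalar and a tensor covariation. Then $(\mathbb X,\mathbb Y)$ admits a global covariation. In particular the global covariation process takes values in $B_1\hat\otimes_\pi B_2$ and $\widetilde{[\mathbb X,\mathbb Y]}=[\mathbb X,\mathbb Y]^\otimes$ a.s.
   Context: Fix $T>0$ and a probability space $(\Omega,\mathcal F,\mathbb P)$. Processes on $[0,T]$ are extended by $\mathbb X_t=\mathbb X_0$ for $t\le0$ and $\mathbb X_t=\mathbb X_T$ for $t\ge T$; they are measurable and such that the integrals below make sense. $\mathscr C([0,T])$ is the space of real continuous processes with the topology of uniform convergence in probability (ucp) on $[0,T]$. $B_1\hat\otimes_\pi B_2$ is the projective tensor product, canonically embedded in its bidual. Scalar covariation: $(\mathbb X,\mathbb Y)$ admits a scalar covariation if $\int_0^\cdot\frac{\|\mathbb X_{s+\epsilon}-\mathbb X_s\|_{B_1}\|\mathbb Y_{s+\epsilon}-\mathbb Y_s\|_{B_2}}{\epsilon}ds$ converges ucp as $\epsilon\downarrow0$. Tensor covariation: $(\mathbb X,\mathbb Y)$ admits a tensor covariation if there is a $B_1\hat\otimes_\pi B_2$-valued process $[\mathbb X,\mathbb Y]^\otimes$ to which the Bochner integrals $\int_0^\cdot\frac{(\mathbb X_{s+\epsilon}-\mathbb X_s)\otimes(\mathbb Y_{s+\epsilon}-\mathbb Y_s)}{\epsilon}ds$ converge ucp (for the norm topology of $B_1\hat\otimes_\pi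 B_2$) as $\epsilon\downarrow0$. Global covariation, i.e. $\chi$-covariation with $\chi=(B_1\hat\otimes_\pi B_2)^*$: $(\mathbb X,\mathbb Y)$ admits it if (H1) every sequence $\epsilon_n\downarrow0$ has a subsequence $(\epsilon_{n_k})$ with $\sup_k\int_0^T\epsilon_{n_k}^{-1}\|(\mathbb X_{s+\epsilon_{n_k}}-\mathbb X_s)\otimes(\mathbb Y_{s+\epsilon_{n_k}}-\mathbb Y_s)\|_{\chi^*}ds<\infty$ a.s.; (H2)(i) there is a map $[\mathbb X,\mathbb Y]:\chi\to\mathscr C([0,T])$ such that for every $\phi\in\chi$, $\int_0^\cdot\langle\phi,\epsilon^{-1}(\mathbb X_{s+\epsilon}-\mathbb X_s)\otimes(\mathbb Y_{s+\epsilon}-\mathbb Y_s)\rangle ds\to[\mathbb X,\mathbb Y](\phi)$ ucp as $\epsilon\to0+$; (H2)(ii) there is a measurable process $\widetilde{[\mathbb X,\mathbb Y]}:\Omega\times[0,T]\to\chi^*$ with a.s. (càdlàg) bounded variation paths such that $\widetilde{[\mathbb X,\mathbb Y]}(\cdot,t)(\phi)=[\mathbb X,\mathbb Y](\phi)(\cdot,t)$ a.s. for all $\phi\in\chi$, $t\in[0,T]$. The $\chi^*$-valued process $\widetilde{[\mathbb X,\mathbb Y]}$ is the global covariation. *)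

theory Defs
  imports "HOL-Probability.Probability"
begin

section \<open>Completion of a seminormed space\<close>

class seminormed_vector = real_vector +
  fixes seminorm :: "'a \<Rightarrow> real"
  assumes seminorm_triangle: "seminorm (x + y) \<le> seminorm x + seminorm y"
    and seminorm_scaleR: "seminorm (r *\<^sub>R x) = \<bar>r\<bar> * seminorm x"

lemma seminorm_zero [simp]: "seminorm (0 :: 'a::seminormed_vector) = 0"
  using seminorm_scaleR[of 0 "0 :: 'a"] by simp

lemma seminorm_minus [simp]: "seminorm (- x) = seminorm (x :: 'a::seminormed_vector)"
  using seminorm_scaleR[of "-1" x] by simp

lemma seminorm_nonneg [simp]: "0 \<le> seminorm (x :: 'a::seminormed_vector)"
  using seminorm_triangle[of x "- x"] by simp

lemma seminorm_minus_commute: "seminorm (x - y) = seminorm (y - x :: 'a::seminormed_vector)"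
  using seminorm_minus[of "x - y"] by simp

lemma seminorm_diff_le: "\<bar>seminorm x - seminorm y\<bar> \<le> seminorm (x - y :: 'a::seminormed_vector)"
  using seminorm_triangle[of "x - y" y] seminorm_triangle[of "y - x" x]
    seminorm_minus_commute[of x y] by simp

definition seminorm_Cauchy :: "(nat \<Rightarrow> 'a::seminormed_vector) \<Rightarrow> bool" where
  "seminorm_Cauchy u \<longleftrightarrow> (\<forall>e>0. \<exists>N. \<forall>m\<ge>N. \<forall>n\<ge>N. seminorm (u m - u n) < e)"

definition Cauchy_rel :: "(nat \<Rightarrow> 'a::seminormed_vector) \<Rightarrow> (nat \<Rightarrow> 'a) \<Rightarrow> bool" where
  "Cauchy_rel u v \<longleftrightarrow> seminorm_Cauchy u \<and> seminorm_Cauchy v \<and> (\<lambda>n. seminorm (u n - v n)) \<longlonglongrightarrow> 0"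

lemma seminorm_Cauchy_const: "seminorm_Cauchy (\<lambda>_. x)"
  by (simp add: seminorm_Cauchy_def)

lemma seminorm_Cauchy_add:
  assumes "seminorm_Cauchy u" "seminorm_Cauchy v"
  shows "seminorm_Cauchy (\<lambda>n. u n + v n)"
  unfolding seminorm_Cauchy_def
proof (intro allI impI)
  fix e :: real assume "e > 0"
  then have "e / 2 > 0" by simp
  obtain N1 where N1: "\<forall>m\<ge>N1. \<forall>n\<ge>N1. seminorm (u m - u n) < e / 2"
    using assms(1) \<open>e / 2 > 0\<close> unfolding seminorm_Cauchy_def by blast
  obtain N2 where N2: "\<forall>m\<ge>N2. \<forall>n\<ge>N2. seminorm (v m - v n) < e / 2"
    using assms(2) \<open>e / 2 > 0\<close> unfolding seminorm_Cauchy_def by blast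
  have "seminorm (u m + v m - (u n + v n)) < e" if "m \<ge> max N1 N2" "n \<ge> max N1 N2" for m n
  proof -
    have "u m + v m - (u n + v n) = (u m - u n) + (v m - v n)" by simp
    then have "seminorm (u m + v m - (u n + v n)) \<le> seminorm (u m - u n) + seminorm (v m - v n)"
      using seminorm_triangle by metis
    moreover have "seminorm (u m - u n) < e / 2" "seminorm (v m - v n) < e / 2"
      using N1 N2 that by auto
    ultimately show ?thesis by linarith
  qed
  then show "\<exists>N. \<forall>m\<ge>N. \<forall>n\<ge>N. seminorm (u m + v m - (u n + v n)) < e" by blast
qed

lemma seminorm_Cauchy_scaleR:
  assumes "seminorm_Cauchy u"
  shows "seminorm_Cauchy (\<lambda>n. r *\<^sub>R u n)"
  unfolding seminorm_Cauchy_def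
proof (intro allI impI)
  fix e :: real assume "e > 0"
  then have "e / (\<bar>r\<bar> + 1) > 0" by simp
  then obtain N where N: "\<forall>m\<ge>N. \<forall>n\<ge>N. seminorm (u m - u n) < e / (\<bar>r\<bar> + 1)"
    using assms unfolding seminorm_Cauchy_def by blast
  have "seminorm (r *\<^sub>R u m - r *\<^sub>R u n) < e" if "m \<ge> N" "n \<ge> N" for m n
  proof -
    have "seminorm (r *\<^sub>R u m - r *\<^sub>R u n) = \<bar>r\<bar> * seminorm (u m - u n)"
      by (simp add: scaleR_right_diff_distrib[symmetric] seminorm_scaleR)
    also have "\<dots> \<le> (\<bar>r\<bar> + 1) * seminorm (u m - u n)"
      by (simp add: mult_right_mono)
    also have "\<dots> < (\<bar>r\<bar> + 1) * (e / (\<bar>r\<bar> + 1))"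
      using N that by (intro mult_strict_left_mono) auto
    also have "\<dots> = e" by simp
    finally show ?thesis .
  qed
  then show "\<exists>N. \<forall>m\<ge>N. \<forall>n\<ge>N. seminorm (r *\<^sub>R u m - r *\<^sub>R u n) < e" by blast
qed

lemma seminorm_Cauchy_norm:
  assumes "seminorm_Cauchy u"
  shows "convergent (\<lambda>n. seminorm (u n))"
proof -
  have "Cauchy (\<lambda>n. seminorm (u n))"
  proof (rule CauchyI)
    fix e :: real assume "e > 0"
    then obtain N where N: "\<forall>m\<ge>N. \<forall>n\<ge>N. seminorm (u m - u n) < e"
      using assms unfolding seminorm_Cauchy_def by blast
    then show "\<exists>N. \<forall>m\<ge>N. \<forall>n\<ge>N. norm (seminorm (u m) - seminorm (u n)) < e"
      using seminorm_diff_le by (metis le_less_trans real_norm_def)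
  qed
  then show ?thesis by (rule Cauchy_convergent)
qed

lemma seminorm_Cauchy_LIMSEQ:
  "seminorm_Cauchy u \<Longrightarrow> (\<lambda>n. seminorm (u n)) \<longlonglongrightarrow> lim (\<lambda>n. seminorm (u n))"
  by (simp add: seminorm_Cauchy_norm convergent_LIMSEQ_iff[symmetric])

lemma seminorm_null_add:
  fixes a b c d :: "nat \<Rightarrow> 'a::seminormed_vector"
  assumes "(\<lambda>n. seminorm (a n - b n)) \<longlonglongrightarrow> 0" "(\<lambda>n. seminorm (c n - d n)) \<longlonglongrightarrow> 0"
  shows "(\<lambda>n. seminorm (a n + c n - (b n + d n))) \<longlonglongrightarrow> 0"
proof (rule tendsto_sandwich[OF _ _ tendsto_const])
  show "(\<lambda>n. seminorm (a n - b n) + seminorm (c n - d n)) \<longlonglongrightarrow> 0"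
    using tendsto_add[OF assms] by simp
  show "\<forall>\<^sub>F n in sequentially. seminorm (a n + c n - (b n + d n))
      \<le> seminorm (a n - b n) + seminorm (c n - d n)"
  proof (intro always_eventually allI)
    fix n
    have "a n + c n - (b n + d n) = (a n - b n) + (c n - d n)" by simp
    then show "seminorm (a n + c n - (b n + d n)) \<le> seminorm (a n - b n) + seminorm (c n - d n)"
      using seminorm_triangle by metis
  qed
qed simp

lemma part_equivp_Cauchy_rel: "part_equivp (Cauchy_rel :: (nat \<Rightarrow> 'a::seminormed_vector) \<Rightarrow> _)"
  (is "part_equivp ?R")
proof (rule part_equivpI)
  show "\<exists>u. ?R u u"
    by (rule exI[of _ "\<lambda>_. 0"]) (simp add: Cauchy_rel_def seminorm_Cauchy_const)
  show "symp ?R"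
    by (auto intro!: sympI simp: Cauchy_rel_def seminorm_minus_commute)
  show "transp ?R"
  proof (rule transpI)
    fix u v w :: "nat \<Rightarrow> 'a" assume *: "Cauchy_rel u v" "Cauchy_rel v w"
    have "(\<lambda>n. seminorm (u n + v n - (v n + w n))) \<longlonglongrightarrow> 0"
      using * by (intro seminorm_null_add) (auto simp: Cauchy_rel_def)
    then show "Cauchy_rel u w" using * by (simp add: Cauchy_rel_def)
  qed
qed

lemma Cauchy_rel_refl: "seminorm_Cauchy u \<Longrightarrow> Cauchy_rel u u"
  by (simp add: Cauchy_rel_def)

text \<open>Cauchy sequences at distance zero are identified, so for a seminorm that is not a norm
  this is the completion of the associated normed quotient.\<close>

quotient_type (overloaded) 'a completion =
  "nat \<Rightarrow> 'a::seminormed_vector" / partial: Cauchy_rel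
  by (rule part_equivp_Cauchy_rel)

lift_definition to_completion :: "'a::seminormed_vector \<Rightarrow> 'a completion" is "\<lambda>x _. x"
  by (simp add: Cauchy_rel_refl seminorm_Cauchy_const)

instantiation completion :: (seminormed_vector) real_normed_vector
begin

lift_definition zero_completion :: "'a completion" is "\<lambda>_. 0"
  by (simp add: Cauchy_rel_refl seminorm_Cauchy_const)

lift_definition plus_completion :: "'a completion \<Rightarrow> 'a completion \<Rightarrow> 'a completion"
  is "\<lambda>u v n. u n + v n"
  by (auto simp: Cauchy_rel_def seminorm_Cauchy_add seminorm_null_add)

lift_definition scaleR_completion :: "real \<Rightarrow> 'a completion \<Rightarrow> 'a completion"
  is "\<lambda>r u n. r *\<^sub>R u n"
proof -
  fix r :: real and u v :: "nat \<Rightarrow> 'a" assume *: "Cauchy_rel u v"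
  have "(\<lambda>n. \<bar>r\<bar> * seminorm (u n - v n)) \<longlonglongrightarrow> 0"
    using * tendsto_mult_right_zero by (auto simp: Cauchy_rel_def)
  then have "(\<lambda>n. seminorm (r *\<^sub>R u n - r *\<^sub>R v n)) \<longlonglongrightarrow> 0"
    by (simp add: scaleR_right_diff_distrib[symmetric] seminorm_scaleR)
  then show "Cauchy_rel (\<lambda>n. r *\<^sub>R u n) (\<lambda>n. r *\<^sub>R v n)"
    using * by (auto simp: Cauchy_rel_def seminorm_Cauchy_scaleR)
qed

definition uminus_completion :: "'a completion \<Rightarrow> 'a completion"
  where "uminus_completion x = (-1) *\<^sub>R x"

definition minus_completion :: "'a completion \<Rightarrow> 'a completion \<Rightarrow> 'a completion"
  where "minus_completion x y = x + (- y)"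

lift_definition norm_completion :: "'a completion \<Rightarrow> real" is "\<lambda>u. lim (\<lambda>n. seminorm (u n))"
proof -
  fix u v :: "nat \<Rightarrow> 'a" assume *: "Cauchy_rel u v"
  have v: "(\<lambda>n. seminorm (v n)) \<longlonglongrightarrow> lim (\<lambda>n. seminorm (v n))"
    using * by (simp add: Cauchy_rel_def seminorm_Cauchy_LIMSEQ)
  have "(\<lambda>n. seminorm (u n) - seminorm (v n)) \<longlonglongrightarrow> 0"
    by (rule Lim_null_comparison[of _ "\<lambda>n. seminorm (u n - v n)"])
      (use * in \<open>auto simp: Cauchy_rel_def seminorm_diff_le\<close>)
  from tendsto_add[OF this v] have "(\<lambda>n. seminorm (u n)) \<longlonglongrightarrow> lim (\<lambda>n. seminorm (v n))"
    by simp
  then show "lim (\<lambda>n. seminorm (u n)) = lim (\<lambda>n. seminorm (v n))" by (rule limI)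
qed

definition dist_completion :: "'a completion \<Rightarrow> 'a completion \<Rightarrow> real"
  where "dist_completion x y = norm (x - y)"

definition [code del]:
  "(uniformity :: ('a completion \<times> 'a completion) filter)
    = (INF e\<in>{0 <..}. principal {(x, y). dist x y < e})"

definition open_completion :: "'a completion set \<Rightarrow> bool"
  where [code del]: "open_completion S = (\<forall>x\<in>S. \<forall>\<^sub>F (x', y) in uniformity. x' = x \<longrightarrow> y \<in> S)"

definition sgn_completion :: "'a completion \<Rightarrow> 'a completion"
  where "sgn_completion x = scaleR (inverse (norm x)) x"

instance
proof
  fix x y z :: "'a completion" and r q :: real
  show "x + y + z = x + (y + z)"
    by transfer (simp add: add.assoc Cauchy_rel_refl seminorm_Cauchy_add Cauchy_rel_def)
  show "x + y = y + x"
    by transfer (simp add: add.commute Cauchy_rel_refl seminorm_Cauchy_add Cauchy_rel_def)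
  show "0 + x = x"
    by transfer (simp add: Cauchy_rel_def)
  show "- x + x = 0"
    unfolding uminus_completion_def
    by transfer (simp add: Cauchy_rel_def seminorm_Cauchy_const)
  show "x - y = x + - y" by (simp add: minus_completion_def)
  show "r *\<^sub>R (x + y) = r *\<^sub>R x + r *\<^sub>R y"
    by transfer (simp add: Cauchy_rel_def scaleR_add_right seminorm_Cauchy_add seminorm_Cauchy_scaleR)
  show "(r + q) *\<^sub>R x = r *\<^sub>R x + q *\<^sub>R x"
    by transfer (simp add: Cauchy_rel_def scaleR_add_left seminorm_Cauchy_add seminorm_Cauchy_scaleR)
  show "r *\<^sub>R q *\<^sub>R x = (r * q) *\<^sub>R x"
    by transfer (simp add: Cauchy_rel_def seminorm_Cauchy_scaleR)
  show "1 *\<^sub>R x = x"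
    by transfer (simp add: Cauchy_rel_def)
  show "dist x y = norm (x - y)" by (simp add: dist_completion_def)
  show "sgn x = inverse (norm x) *\<^sub>R x" by (simp add: sgn_completion_def)
  show "uniformity = (INF e\<in>{0 <..}. principal {(x::'a completion, y). dist x y < e})"
    by (rule uniformity_completion_def)
  show "open U = (\<forall>x\<in>U. \<forall>\<^sub>F (x', y) in uniformity. x' = x \<longrightarrow> y \<in> U)" for U :: "'a completion set"
    by (rule open_completion_def)
  show "(norm x = 0) = (x = 0)"
  proof (transfer, unfold Cauchy_rel_def, safe)
    fix u :: "nat \<Rightarrow> 'a"
    assume u: "seminorm_Cauchy u"
    then have L: "(\<lambda>n. seminorm (u n)) \<longlonglongrightarrow> lim (\<lambda>n. seminorm (u n))"
      using seminorm_Cauchy_LIMSEQ by blast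
    show "seminorm_Cauchy (\<lambda>_. 0 :: 'a)" by (rule seminorm_Cauchy_const)
    show "(\<lambda>n. seminorm (u n - 0)) \<longlonglongrightarrow> 0" if "lim (\<lambda>n. seminorm (u n)) = 0"
      using L that by simp
    show "lim (\<lambda>n. seminorm (u n)) = 0" if "(\<lambda>n. seminorm (u n - 0)) \<longlonglongrightarrow> 0"
      using that limI by simp
  qed
  show "norm (x + y) \<le> norm x + norm y"
  proof (transfer, unfold Cauchy_rel_def, elim conjE)
    fix u v :: "nat \<Rightarrow> 'a"
    assume u: "seminorm_Cauchy u" and v: "seminorm_Cauchy v"
    have Lu: "(\<lambda>n. seminorm (u n)) \<longlonglongrightarrow> lim (\<lambda>n. seminorm (u n))"
      and Lv: "(\<lambda>n. seminorm (v n)) \<longlonglongrightarrow> lim (\<lambda>n. seminorm (v n))"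
      and Luv: "(\<lambda>n. seminorm (u n + v n)) \<longlonglongrightarrow> lim (\<lambda>n. seminorm (u n + v n))"
      using u v seminorm_Cauchy_add[OF u v] seminorm_Cauchy_LIMSEQ by blast+
    show "lim (\<lambda>n. seminorm (u n + v n)) \<le> lim (\<lambda>n. seminorm (u n)) + lim (\<lambda>n. seminorm (v n))"
      by (rule LIMSEQ_le[OF Luv tendsto_add[OF Lu Lv]]) (auto intro: seminorm_triangle)
  qed
  show "norm (r *\<^sub>R x) = \<bar>r\<bar> * norm x"
  proof (transfer, unfold Cauchy_rel_def, elim conjE)
    fix r :: real and u :: "nat \<Rightarrow> 'a"
    assume u: "seminorm_Cauchy u"
    then have "(\<lambda>n. seminorm (u n)) \<longlonglongrightarrow> lim (\<lambda>n. seminorm (u n))"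
      using seminorm_Cauchy_LIMSEQ by blast
    then have "(\<lambda>n. \<bar>r\<bar> * seminorm (u n)) \<longlonglongrightarrow> \<bar>r\<bar> * lim (\<lambda>n. seminorm (u n))"
      by (intro tendsto_mult_left)
    then show "lim (\<lambda>n. seminorm (r *\<^sub>R u n)) = \<bar>r\<bar> * lim (\<lambda>n. seminorm (u n))"
      by (simp add: seminorm_scaleR limI)
  qed
qed

end

lemma to_completion_add: "to_completion (x + y) = to_completion x + to_completion y"
  by transfer (simp add: Cauchy_rel_refl seminorm_Cauchy_const)

lemma to_completion_scaleR: "to_completion (r *\<^sub>R x) = r *\<^sub>R to_completion x"
  by transfer (simp add: Cauchy_rel_refl seminorm_Cauchy_const)

lemma to_completion_diff: "to_completion (x - y) = to_completion x - to_completion y"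
  using to_completion_add[of x "(-1) *\<^sub>R y"] to_completion_scaleR[of "-1" y] by simp

lemma norm_to_completion: "norm (to_completion x) = seminorm x"
  by transfer (simp add: limI)

lemma to_completion_LIMSEQ:
  fixes u :: "nat \<Rightarrow> 'a::seminormed_vector"
  assumes u: "seminorm_Cauchy u"
  shows "(\<lambda>n. to_completion (u n)) \<longlonglongrightarrow> abs_completion u"
proof (rule LIMSEQ_I)
  fix e :: real assume "e > 0"
  then have "e / 2 > 0" by simp
  then obtain N where N: "\<forall>m\<ge>N. \<forall>n\<ge>N. seminorm (u m - u n) < e / 2"
    using u unfolding seminorm_Cauchy_def by blast
  have "norm (to_completion (u n) - abs_completion u) < e" if "n \<ge> N" for n
  proof -
    define v where "v = (\<lambda>k. u n + (-1) *\<^sub>R u k)"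
    have v: "seminorm_Cauchy v"
      unfolding v_def by (intro seminorm_Cauchy_add seminorm_Cauchy_const seminorm_Cauchy_scaleR u)
    have "(-1) *\<^sub>R abs_completion u = abs_completion (\<lambda>k. (-1) *\<^sub>R u k)"
      using u by (intro scaleR_completion.abs_eq Cauchy_rel_refl)
    moreover have "abs_completion (\<lambda>_. u n) + abs_completion (\<lambda>k. (-1) *\<^sub>R u k) = abs_completion v"
      unfolding v_def
      by (intro plus_completion.abs_eq Cauchy_rel_refl seminorm_Cauchy_const seminorm_Cauchy_scaleR u)
    ultimately have "to_completion (u n) - abs_completion u = abs_completion v"
      by (metis to_completion.abs_eq diff_conv_add_uminus scaleR_minus1_left)
    then have "norm (to_completion (u n) - abs_completion u) = lim (\<lambda>k. seminorm (v k))"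
      using v by (simp add: norm_completion.abs_eq Cauchy_rel_refl)
    moreover have "lim (\<lambda>k. seminorm (v k)) \<le> e / 2"
    proof (rule LIMSEQ_le_const2)
      show "(\<lambda>k. seminorm (v k)) \<longlonglongrightarrow> lim (\<lambda>k. seminorm (v k))"
        using v seminorm_Cauchy_LIMSEQ by blast
      show "\<exists>K. \<forall>k\<ge>K. seminorm (v k) \<le> e / 2"
        using N that by (intro exI[of _ N]) (auto simp: v_def less_imp_le)
    qed
    ultimately show ?thesis using \<open>e > 0\<close> by simp
  qed
  then show "\<exists>N. \<forall>n\<ge>N. norm (to_completion (u n) - abs_completion u) < e" by blast
qed

lemma to_completion_dense:
  fixes x :: "'a::seminormed_vector completion"
  assumes "e > 0"
  shows "\<exists>y. norm (x - to_completion y) < e"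
proof -
  obtain u where u: "seminorm_Cauchy u" "x = abs_completion u"
    using Quotient3_rep_reflp[OF Quotient3_completion, of x] Quotient3_abs_rep[OF Quotient3_completion, of x]
    by (metis Cauchy_rel_def)
  obtain n where "norm (to_completion (u n) - x) < e"
    using LIMSEQ_D[OF to_completion_LIMSEQ[OF u(1)] assms] u(2) by blast
  then show ?thesis by (metis norm_minus_commute)
qed

instance completion :: (seminormed_vector) banach
proof
  fix X :: "nat \<Rightarrow> 'a completion" assume X: "Cauchy X"
  have "\<forall>n. \<exists>y. norm (X n - to_completion y) < inverse (real (Suc n))"
    by (intro allI to_completion_dense) simp
  then obtain u where u: "\<And>n. norm (X n - to_completion (u n)) < inverse (real (Suc n))"
    by metis
  have *: "(\<lambda>n. X n - to_completion (u n)) \<longlonglongrightarrow> 0"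
    by (rule Lim_null_comparison[OF _ LIMSEQ_inverse_real_of_nat])
      (intro always_eventually allI less_imp_le[OF u])
  define d where "d = (\<lambda>n. X n - to_completion (u n))"
  have d: "Cauchy d" unfolding d_def by (rule LIMSEQ_imp_Cauchy[OF *])
  have "Cauchy (\<lambda>n. to_completion (u n))"
  proof (rule CauchyI)
    fix e :: real assume "e > 0"
    then have "e / 2 > 0" by simp
    obtain N1 where N1: "\<forall>m\<ge>N1. \<forall>n\<ge>N1. norm (X m - X n) < e / 2"
      using CauchyD[OF X \<open>e / 2 > 0\<close>] by blast
    obtain N2 where N2: "\<forall>m\<ge>N2. \<forall>n\<ge>N2. norm (d m - d n) < e / 2"
      using CauchyD[OF d \<open>e / 2 > 0\<close>] by blast
    have "norm (to_completion (u m) - to_completion (u n)) < e"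
      if "m \<ge> max N1 N2" "n \<ge> max N1 N2" for m n
    proof -
      have "to_completion (u m) - to_completion (u n) = (X m - X n) - (d m - d n)"
        by (simp add: d_def)
      then have "norm (to_completion (u m) - to_completion (u n)) \<le> norm (X m - X n) + norm (d m - d n)"
        by (metis norm_triangle_ineq4)
      moreover have "norm (X m - X n) < e / 2" "norm (d m - d n) < e / 2"
        using N1 N2 that by auto
      ultimately show ?thesis by linarith
    qed
    then show "\<exists>N. \<forall>m\<ge>N. \<forall>n\<ge>N. norm (to_completion (u m) - to_completion (u n)) < e" by blast
  qed
  then have "seminorm_Cauchy u"
    unfolding seminorm_Cauchy_def Cauchy_iff
    by (simp add: to_completion_diff[symmetric] norm_to_completion)
  from tendsto_add[OF * to_completion_LIMSEQ[OF this]] have "X \<longlonglongrightarrow> abs_completion u"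
    by simp
  then show "convergent X" by (rule convergentI)
qed


section \<open>The projective tensor product\<close>

text \<open>The algebraic tensor product is realised as the span of the functionals
  \<open>x \<otimes> y : B \<mapsto> B x y\<close> on the space of all (not necessarily bounded) bilinear forms.
  Scalars are absorbed into the factors, so that every element is a finite sum
  \<open>x\<^sub>1 \<otimes> y\<^sub>1 + \<dots> + x\<^sub>k \<otimes> y\<^sub>k\<close>. The value 0 off the bilinear forms is a dummy.\<close>

typedef (overloaded) ('a, 'b) alg_tensor =
  "{u :: ('a::real_vector \<Rightarrow> 'b::real_vector \<Rightarrow> real) \<Rightarrow> real.
     \<exists>zs. u = (\<lambda>B. if bilinear B then \<Sum>(x, y)\<leftarrow>zs. B x y else 0)}"
  by blast

setup_lifting type_definition_alg_tensor

lift_definition tensor_sum :: "('a::real_vector \<times> 'b::real_vector) list \<Rightarrow> ('a, 'b) alg_tensor"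
  is "\<lambda>zs B. if bilinear B then \<Sum>(x, y)\<leftarrow>zs. B x y else 0"
  by blast

instantiation alg_tensor :: (real_vector, real_vector) real_vector
begin

lift_definition zero_alg_tensor :: "('a, 'b) alg_tensor" is "\<lambda>B. 0"
  by (intro exI[of _ "[]"]) auto

lift_definition plus_alg_tensor :: "('a, 'b) alg_tensor \<Rightarrow> ('a, 'b) alg_tensor \<Rightarrow> ('a, 'b) alg_tensor"
  is "\<lambda>u v B. u B + v B"
proof -
  fix u v :: "('a \<Rightarrow> 'b \<Rightarrow> real) \<Rightarrow> real"
  assume "\<exists>zs. u = (\<lambda>B. if bilinear B then \<Sum>(x, y)\<leftarrow>zs. B x y else 0)"
    and "\<exists>zs. v = (\<lambda>B. if bilinear B then \<Sum>(x, y)\<leftarrow>zs. B x y else 0)"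
  then obtain zs zs' where "u = (\<lambda>B. if bilinear B then \<Sum>(x, y)\<leftarrow>zs. B x y else 0)"
    "v = (\<lambda>B. if bilinear B then \<Sum>(x, y)\<leftarrow>zs'. B x y else 0)" by blast
  then show "\<exists>zs. (\<lambda>B. u B + v B) = (\<lambda>B. if bilinear B then \<Sum>(x, y)\<leftarrow>zs. B x y else 0)"
    by (intro exI[of _ "zs @ zs'"]) auto
qed

lift_definition scaleR_alg_tensor :: "real \<Rightarrow> ('a, 'b) alg_tensor \<Rightarrow> ('a, 'b) alg_tensor"
  is "\<lambda>r u B. r * u B"
proof -
  fix r :: real and u :: "('a \<Rightarrow> 'b \<Rightarrow> real) \<Rightarrow> real"
  assume "\<exists>zs. u = (\<lambda>B. if bilinear B then \<Sum>(x, y)\<leftarrow>zs. B x y else 0)"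
  then obtain zs where u: "u = (\<lambda>B. if bilinear B then \<Sum>(x, y)\<leftarrow>zs. B x y else 0)" by blast
  have "r * (\<Sum>(x, y)\<leftarrow>zs. B x y) = (\<Sum>(x, y)\<leftarrow>map (\<lambda>(x, y). (r *\<^sub>R x, y)) zs. B x y)"
    if "bilinear B" for B :: "'a \<Rightarrow> 'b \<Rightarrow> real"
    using that by (induction zs) (auto simp: bilinear_lmul algebra_simps)
  then show "\<exists>zs. (\<lambda>B. r * u B) = (\<lambda>B. if bilinear B then \<Sum>(x, y)\<leftarrow>zs. B x y else 0)"
    unfolding u by (intro exI[of _ "map (\<lambda>(x, y). (r *\<^sub>R x, y)) zs"]) auto
qed

definition uminus_alg_tensor :: "('a, 'b) alg_tensor \<Rightarrow> ('a, 'b) alg_tensor"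
  where "uminus_alg_tensor u = (-1) *\<^sub>R u"

definition minus_alg_tensor :: "('a, 'b) alg_tensor \<Rightarrow> ('a, 'b) alg_tensor \<Rightarrow> ('a, 'b) alg_tensor"
  where "minus_alg_tensor u v = u + (- v)"

instance
  by standard (unfold uminus_alg_tensor_def minus_alg_tensor_def,
      (transfer, auto simp: algebra_simps)+)

end

lemma tensor_sum_append: "tensor_sum (xs @ ys) = tensor_sum xs + tensor_sum ys"
  by transfer auto

lemma tensor_sum_scaleR: "r *\<^sub>R tensor_sum zs = tensor_sum (map (\<lambda>(x, y). (r *\<^sub>R x, y)) zs)"
proof (transfer, rule ext)
  fix r :: real and zs :: "('a \<times> 'b) list" and B :: "'a \<Rightarrow> 'b \<Rightarrow> real"
  have "r * (\<Sum>(x, y)\<leftarrow>zs. B x y) = (\<Sum>(x, y)\<leftarrow>map (\<lambda>(x, y). (r *\<^sub>R x, y)) zs. B x y)"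
    if "bilinear B"
    using that by (induction zs) (auto simp: bilinear_lmul algebra_simps)
  then show "r * (if bilinear B then \<Sum>(x, y)\<leftarrow>zs. B x y else 0) =
    (if bilinear B then \<Sum>(x, y)\<leftarrow>map (\<lambda>(x, y). (r *\<^sub>R x, y)) zs. B x y else 0)" by simp
qed

lemma tensor_sum_surj: "\<exists>zs. u = tensor_sum zs"
  by transfer blast

abbreviation tensor_cost :: "('a::real_normed_vector \<times> 'b::real_normed_vector) list \<Rightarrow> real" where
  "tensor_cost zs \<equiv> \<Sum>(x, y)\<leftarrow>zs. norm x * norm y"

definition projective_norm :: "('a::real_normed_vector, 'b::real_normed_vector) alg_tensor \<Rightarrow> real" where
  "projective_norm u = Inf {tensor_cost zs | zs. u = tensor_sum zs}"

lemma tensor_cost_nonneg: "0 \<le> tensor_cost zs"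
  by (induction zs) auto

lemma projective_norm_le: "projective_norm (tensor_sum zs) \<le> tensor_cost zs"
  unfolding projective_norm_def
  by (rule cInf_lower) (auto intro!: bdd_belowI[of _ 0] tensor_cost_nonneg)

lemma projective_norm_approx:
  assumes "e > 0"
  shows "\<exists>zs. u = tensor_sum zs \<and> tensor_cost zs < projective_norm u + e"
proof -
  have "{tensor_cost zs | zs. u = tensor_sum zs} \<noteq> {}" using tensor_sum_surj[of u] by blast
  from cInf_lessD[OF this, of "projective_norm u + e"] assms
  show ?thesis unfolding projective_norm_def by auto
qed

lemma projective_norm_nonneg: "0 \<le> projective_norm u"
  unfolding projective_norm_def
  using tensor_sum_surj[of u] by (intro cInf_greatest) (auto intro: tensor_cost_nonneg)

lemma projective_norm_triangle: "projective_norm (u + v) \<le> projective_norm u + projective_norm v"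
proof (rule field_le_epsilon)
  fix e :: real assume "e > 0"
  then have "e / 2 > 0" by simp
  obtain zs where zs: "u = tensor_sum zs" "tensor_cost zs < projective_norm u + e / 2"
    using projective_norm_approx[OF \<open>e / 2 > 0\<close>] by blast
  obtain zs' where zs': "v = tensor_sum zs'" "tensor_cost zs' < projective_norm v + e / 2"
    using projective_norm_approx[OF \<open>e / 2 > 0\<close>] by blast
  have "projective_norm (u + v) \<le> tensor_cost (zs @ zs')"
    using projective_norm_le[of "zs @ zs'"] zs(1) zs'(1) by (simp add: tensor_sum_append)
  then show "projective_norm (u + v) \<le> projective_norm u + projective_norm v + e"
    using zs(2) zs'(2) by simp
qed

lemma projective_norm_scaleR_le: "projective_norm (r *\<^sub>R u) \<le> \<bar>r\<bar> * projective_norm u"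
proof (rule field_le_epsilon)
  fix e :: real assume "e > 0"
  then have "e / (\<bar>r\<bar> + 1) > 0" by simp
  then obtain zs where zs: "u = tensor_sum zs" "tensor_cost zs < projective_norm u + e / (\<bar>r\<bar> + 1)"
    using projective_norm_approx by blast
  have cost: "tensor_cost (map (\<lambda>(x, y). (r *\<^sub>R x, y)) zs) = \<bar>r\<bar> * tensor_cost zs"
    by (induction zs) (auto simp: algebra_simps)
  have "projective_norm (r *\<^sub>R u) \<le> \<bar>r\<bar> * tensor_cost zs"
    using projective_norm_le[of "map (\<lambda>(x, y). (r *\<^sub>R x, y)) zs"] unfolding cost
    by (simp add: zs(1) tensor_sum_scaleR)
  also have "\<dots> \<le> \<bar>r\<bar> * (projective_norm u + e / (\<bar>r\<bar> + 1))"
    using zs(2) by (intro mult_left_mono) auto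
  also have "\<dots> \<le> \<bar>r\<bar> * projective_norm u + e"
    using \<open>e > 0\<close> by (simp add: field_simps)
  finally show "projective_norm (r *\<^sub>R u) \<le> \<bar>r\<bar> * projective_norm u + e" .
qed

lemma projective_norm_scaleR: "projective_norm (r *\<^sub>R u) = \<bar>r\<bar> * projective_norm u"
proof (cases "r = 0")
  case True
  then show ?thesis
    using projective_norm_scaleR_le[of r u] projective_norm_nonneg[of "r *\<^sub>R u"] by simp
next
  case False
  have "projective_norm u \<le> \<bar>inverse r\<bar> * projective_norm (r *\<^sub>R u)"
    using projective_norm_scaleR_le[of "inverse r" "r *\<^sub>R u"] False by simp
  then have "\<bar>r\<bar> * projective_norm u \<le> projective_norm (r *\<^sub>R u)"
    using False by (simp add: field_simps)
  then show ?thesis using projective_norm_scaleR_le[of r u] by simp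
qed

instantiation alg_tensor :: (real_normed_vector, real_normed_vector) seminormed_vector
begin

definition "seminorm_alg_tensor = (projective_norm :: ('a, 'b) alg_tensor \<Rightarrow> real)"

instance
  by standard (auto simp: seminorm_alg_tensor_def projective_norm_triangle projective_norm_scaleR)

end

type_synonym ('a, 'b) proj_tensor = "('a, 'b) alg_tensor completion"

definition tensor :: "'a::real_normed_vector \<Rightarrow> 'b::real_normed_vector \<Rightarrow> ('a, 'b) proj_tensor"
    (infixr "\<otimes>\<^sub>\<pi>" 75) where
  "x \<otimes>\<^sub>\<pi> y = to_completion (tensor_sum [(x, y)])"

text \<open>The dual of the projective tensor product (the space \<open>\<chi>\<close> of the global covariation) and
  its bidual.\<close>

type_synonym ('a, 'b) tensor_dual = "('a, 'b) proj_tensor \<Rightarrow>\<^sub>L real"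
type_synonym ('a, 'b) tensor_bidual = "('a, 'b) tensor_dual \<Rightarrow>\<^sub>L real"

lift_definition canonical_embedding :: "'a::real_normed_vector \<Rightarrow> (('a \<Rightarrow>\<^sub>L real) \<Rightarrow>\<^sub>L real)"
  is "\<lambda>x \<phi>. blinfun_apply \<phi> x"
  by (rule bounded_linear_intros blinfun.bounded_linear_left)+


section \<open>Strong measurability and the Bochner integral\<close>

text \<open>The Bochner integral of the library requires a second countable range. The definitions below
  repeat it for arbitrary normed spaces, with Borel measurability replaced by strong measurability
  (the two agree for separable range).\<close>

definition strongly_measurable :: "'c measure \<Rightarrow> ('c \<Rightarrow> 'd::topological_space) \<Rightarrow> bool" where
  "strongly_measurable M f \<longleftrightarrow>
     (\<exists>s. (\<forall>i. simple_function M (s i)) \<and> (\<forall>x\<in>space M. (\<lambda>i. s i x) \<longlonglongrightarrow> f x))"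

definition bochner_has_integral :: "'c measure \<Rightarrow> ('c \<Rightarrow> 'd::real_normed_vector) \<Rightarrow> 'd \<Rightarrow> bool" where
  "bochner_has_integral M f I \<longleftrightarrow> strongly_measurable M f \<and>
     (\<exists>s. (\<forall>i. Bochner_Integration.simple_bochner_integrable M (s i)) \<and>
          (\<lambda>i. \<integral>\<^sup>+x. ennreal (norm (f x - s i x)) \<partial>M) \<longlonglongrightarrow> 0 \<and>
          (\<lambda>i. Bochner_Integration.simple_bochner_integral M (s i)) \<longlonglongrightarrow> I)"

definition bochner_integrable :: "'c measure \<Rightarrow> ('c \<Rightarrow> 'd::real_normed_vector) \<Rightarrow> bool" where
  "bochner_integrable M f \<longleftrightarrow> (\<exists>I. bochner_has_integral M f I)"

definition bochner_integral :: "'c measure \<Rightarrow> ('c \<Rightarrow> 'd::real_normed_vector) \<Rightarrow> 'd" where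
  "bochner_integral M f = (THE I. bochner_has_integral M f I)"


section \<open>Processes on \<open>[0,T]\<close>\<close>

text \<open>A process is a function of time and scenario; only its values at times in \<open>[0,T]\<close> matter.\<close>

definition measurable_process ::
    "'w measure \<Rightarrow> real \<Rightarrow> (real \<Rightarrow> 'w \<Rightarrow> 'd::topological_space) \<Rightarrow> bool" where
  "measurable_process M T X \<longleftrightarrow>
     (\<lambda>(t, \<omega>). X t \<omega>) \<in> borel_measurable (restrict_space borel {0..T} \<Otimes>\<^sub>M M)"

text \<open>Joint measurability in Bochner's sense, required of the tensor and the global covariation; for
  separable range it is the same as \<^const>\<open>measurable_process\<close>. For nonseparable ranges Borel
  measurability would not make the \<open>\<chi>\<^sup>*\<close>-valued process unique up to a null set, because it is
  characterised only by testing against each fixed \<open>\<phi>\<close>.\<close>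

definition strongly_measurable_process ::
    "'w measure \<Rightarrow> real \<Rightarrow> (real \<Rightarrow> 'w \<Rightarrow> 'd::topological_space) \<Rightarrow> bool" where
  "strongly_measurable_process M T X \<longleftrightarrow>
     strongly_measurable (restrict_space borel {0..T} \<Otimes>\<^sub>M M) (\<lambda>(t, \<omega>). X t \<omega>)"

text \<open>The space \<open>\<C>([0,T])\<close>.\<close>

definition continuous_process :: "'w measure \<Rightarrow> real \<Rightarrow> (real \<Rightarrow> 'w \<Rightarrow> real) \<Rightarrow> bool" where
  "continuous_process M T X \<longleftrightarrow>
     measurable_process M T X \<and> (\<forall>\<omega>\<in>space M. continuous_on {0..T} (\<lambda>t. X t \<omega>))"

definition extend_process :: "real \<Rightarrow> (real \<Rightarrow> 'w \<Rightarrow> 'd) \<Rightarrow> real \<Rightarrow> 'w \<Rightarrow> 'd" where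
  "extend_process T X t \<omega> = X (max 0 (min t T)) \<omega>"

definition increment :: "real \<Rightarrow> (real \<Rightarrow> 'w \<Rightarrow> 'd::minus) \<Rightarrow> real \<Rightarrow> real \<Rightarrow> 'w \<Rightarrow> 'd" where
  "increment T X \<epsilon> s \<omega> = extend_process T X (s + \<epsilon>) \<omega> - extend_process T X s \<omega>"

text \<open>Convergence uniformly in probability on \<open>[0,T]\<close> as \<open>\<epsilon> \<down> 0\<close>. The event says that the supremum
  over \<open>t\<close> exceeds \<open>\<delta>\<close>. It need not be measurable for general families \<open>F\<close> and limits \<open>L\<close>, hence the
  outer measure, which is the probability whenever the event is measurable.\<close>

definition ucp_converges ::
    "'w measure \<Rightarrow> real \<Rightarrow> (real \<Rightarrow> real \<Rightarrow> 'w \<Rightarrow> 'd::real_normed_vector) \<Rightarrow> (real \<Rightarrow> 'w \<Rightarrow> 'd) \<Rightarrow> bool" where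
  "ucp_converges M T F L \<longleftrightarrow>
     (\<forall>\<delta>>0. ((\<lambda>\<epsilon>. outer_measure_of M {\<omega>\<in>space M. \<exists>t\<in>{0..T}. \<delta> < norm (F \<epsilon> t \<omega> - L t \<omega>)})
              \<longlongrightarrow> 0) (at_right 0))"

definition cadlag_on :: "real \<Rightarrow> (real \<Rightarrow> 'd::topological_space) \<Rightarrow> bool" where
  "cadlag_on T f \<longleftrightarrow>
     (\<forall>t\<in>{0..<T}. (f \<longlongrightarrow> f t) (at_right t)) \<and> (\<forall>t\<in>{0<..T}. \<exists>l. (f \<longlongrightarrow> l) (at_left t))"

definition bounded_variation_on :: "real \<Rightarrow> (real \<Rightarrow> 'd::real_normed_vector) \<Rightarrow> bool" where
  "bounded_variation_on T f \<longleftrightarrow>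
     (\<exists>C. \<forall>n p. (\<forall>i<n. p i \<le> p (Suc i)) \<and> (\<forall>i\<le>n. p i \<in> {0..T}) \<longrightarrow>
        (\<Sum>i<n. norm (f (p (Suc i)) - f (p i))) \<le> C)"


section \<open>Scalar, tensor and global covariation\<close>

definition scalar_integrand ::
    "real \<Rightarrow> (real \<Rightarrow> 'w \<Rightarrow> 'a::real_normed_vector) \<Rightarrow> (real \<Rightarrow> 'w \<Rightarrow> 'b::real_normed_vector) \<Rightarrow>
     real \<Rightarrow> real \<Rightarrow> 'w \<Rightarrow> real" where
  "scalar_integrand T X Y \<epsilon> s \<omega> = norm (increment T X \<epsilon> s \<omega>) * norm (increment T Y \<epsilon> s \<omega>) / \<epsilon>"

definition tensor_integrand ::
    "real \<Rightarrow> (real \<Rightarrow> 'w \<Rightarrow> 'a::real_normed_vector) \<Rightarrow> (real \<Rightarrow> 'w \<Rightarrow> 'b::real_normed_vector) \<Rightarrow>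
     real \<Rightarrow> real \<Rightarrow> 'w \<Rightarrow> ('a, 'b) proj_tensor" where
  "tensor_integrand T X Y \<epsilon> s \<omega> =
     (1 / \<epsilon>) *\<^sub>R (increment T X \<epsilon> s \<omega> \<otimes>\<^sub>\<pi> increment T Y \<epsilon> s \<omega>)"

text \<open>The standing assumption that the integrals in the definitions of the covariations make
  sense.\<close>

definition covariation_integrals_exist ::
    "'w measure \<Rightarrow> real \<Rightarrow> (real \<Rightarrow> 'w \<Rightarrow> 'a::real_normed_vector) \<Rightarrow> (real \<Rightarrow> 'w \<Rightarrow> 'b::real_normed_vector) \<Rightarrow> bool" where
  "covariation_integrals_exist M T X Y \<longleftrightarrow>
     (\<forall>\<epsilon>>0. AE \<omega> in M.
        set_integrable lborel {0..T} (\<lambda>s. scalar_integrand T X Y \<epsilon> s \<omega>) \<and>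
        bochner_integrable lborel (\<lambda>s. indicator {0..T} s *\<^sub>R tensor_integrand T X Y \<epsilon> s \<omega>))"

definition admits_scalar_covariation ::
    "'w measure \<Rightarrow> real \<Rightarrow> (real \<Rightarrow> 'w \<Rightarrow> 'a::real_normed_vector) \<Rightarrow> (real \<Rightarrow> 'w \<Rightarrow> 'b::real_normed_vector) \<Rightarrow> bool" where
  "admits_scalar_covariation M T X Y \<longleftrightarrow>
     (\<exists>L. continuous_process M T L \<and>
        ucp_converges M T (\<lambda>\<epsilon> t \<omega>. LINT s:{0..t}|lborel. scalar_integrand T X Y \<epsilon> s \<omega>) L)"

definition is_tensor_covariation ::
    "'w measure \<Rightarrow> real \<Rightarrow> (real \<Rightarrow> 'w \<Rightarrow> 'a::real_normed_vector) \<Rightarrow> (real \<Rightarrow> 'w \<Rightarrow> 'b::real_normed_vector) \<Rightarrow>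
     (real \<Rightarrow> 'w \<Rightarrow> ('a, 'b) proj_tensor) \<Rightarrow> bool" where
  "is_tensor_covariation M T X Y Z \<longleftrightarrow>
     strongly_measurable_process M T Z \<and>
     ucp_converges M T
       (\<lambda>\<epsilon> t \<omega>. bochner_integral lborel (\<lambda>s. indicator {0..t} s *\<^sub>R tensor_integrand T X Y \<epsilon> s \<omega>)) Z"

definition admits_tensor_covariation ::
    "'w measure \<Rightarrow> real \<Rightarrow> (real \<Rightarrow> 'w \<Rightarrow> 'a::real_normed_vector) \<Rightarrow> (real \<Rightarrow> 'w \<Rightarrow> 'b::real_normed_vector) \<Rightarrow> bool" where
  "admits_tensor_covariation M T X Y \<longleftrightarrow> (\<exists>Z. is_tensor_covariation M T X Y Z)"

definition global_H1 ::
    "'w measure \<Rightarrow> real \<Rightarrow> (real \<Rightarrow> 'w \<Rightarrow> 'a::real_normed_vector) \<Rightarrow> (real \<Rightarrow> 'w \<Rightarrow> 'b::real_normed_vector) \<Rightarrow> bool" where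
  "global_H1 M T X Y \<longleftrightarrow>
     (\<forall>e. (\<forall>n. 0 < e n) \<and> decseq e \<and> e \<longlonglongrightarrow> 0 \<longrightarrow>
        (\<exists>r :: nat \<Rightarrow> nat. strict_mono r \<and>
           (AE \<omega> in M.
              (SUP k. \<integral>\<^sup>+s\<in>{0..T}. ennreal (norm (canonical_embedding
                 (increment T X (e (r k)) s \<omega> \<otimes>\<^sub>\<pi> increment T Y (e (r k)) s \<omega>)) / e (r k)) \<partial>lborel) < \<infinity>)))"

definition global_H2i ::
    "'w measure \<Rightarrow> real \<Rightarrow> (real \<Rightarrow> 'w \<Rightarrow> 'a::real_normed_vector) \<Rightarrow> (real \<Rightarrow> 'w \<Rightarrow> 'b::real_normed_vector) \<Rightarrow>
     (('a, 'b) tensor_dual \<Rightarrow> real \<Rightarrow> 'w \<Rightarrow> real) \<Rightarrow> bool" where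
  "global_H2i M T X Y Q \<longleftrightarrow>
     (\<forall>\<phi>. continuous_process M T (Q \<phi>) \<and>
        ucp_converges M T
          (\<lambda>\<epsilon> t \<omega>. LINT s:{0..t}|lborel. blinfun_apply \<phi> (tensor_integrand T X Y \<epsilon> s \<omega>)) (Q \<phi>))"

definition global_H2ii ::
    "'w measure \<Rightarrow> real \<Rightarrow> (('a::real_normed_vector, 'b::real_normed_vector) tensor_dual \<Rightarrow> real \<Rightarrow> 'w \<Rightarrow> real) \<Rightarrow>
     (real \<Rightarrow> 'w \<Rightarrow> ('a, 'b) tensor_bidual) \<Rightarrow> bool" where
  "global_H2ii M T Q W \<longleftrightarrow>
     strongly_measurable_process M T W \<and>
     (AE \<omega> in M. cadlag_on T (\<lambda>t. W t \<omega>) \<and> bounded_variation_on T (\<lambda>t. W t \<omega>)) \<and>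
     (\<forall>\<phi>. \<forall>t\<in>{0..T}. AE \<omega> in M. blinfun_apply (W t \<omega>) \<phi> = Q \<phi> t \<omega>)"

definition is_global_covariation ::
    "'w measure \<Rightarrow> real \<Rightarrow> (real \<Rightarrow> 'w \<Rightarrow> 'a::real_normed_vector) \<Rightarrow> (real \<Rightarrow> 'w \<Rightarrow> 'b::real_normed_vector) \<Rightarrow>
     (real \<Rightarrow> 'w \<Rightarrow> ('a, 'b) tensor_bidual) \<Rightarrow> bool" where
  "is_global_covariation M T X Y W \<longleftrightarrow>
     global_H1 M T X Y \<and> (\<exists>Q. global_H2i M T X Y Q \<and> global_H2ii M T Q W)"

definition admits_global_covariation ::
    "'w measure \<Rightarrow> real \<Rightarrow> (real \<Rightarrow> 'w \<Rightarrow> 'a::real_normed_vector) \<Rightarrow> (real \<Rightarrow> 'w \<Rightarrow> 'b::real_normed_vector) \<Rightarrow> bool" where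
  "admits_global_covariation M T X Y \<longleftrightarrow> (\<exists>W. is_global_covariation M T X Y W)"

end

theory Submission
  imports Defs
begin

text \<open>
  Everything rests on the bound
  \<open>\<parallel>\<xi> \<otimes> \<eta>\<parallel> \<le> \<parallel>\<xi>\<parallel> \<parallel>\<eta>\<parallel>\<close> for the projective norm. It makes the tensor integrand pointwise smaller
  than the scalar integrand, so an increment over \<open>[s,t]\<close> of the approximating tensor integral is at
  most the increment of the approximating scalar integral. Along a common sequence \<open>\<epsilon>\<^sub>k \<down> 0\<close> on
  which both converge almost surely, this passes to the limits: if \<open>L\<close> is the scalar and \<open>Z\<close> a
  tensor covariation, then almost surely \<open>\<parallel>Z\<^sub>t - Z\<^sub>s\<parallel> \<le> L\<^sub>t - L\<^sub>s\<close> for all \<open>s \<le> t\<close>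
  (\<open>tensor_covariation_increment_le\<close>). As \<open>L\<close> has continuous paths, almost all paths of \<open>Z\<close> are
  continuous and of bounded variation.

  Existence: resetting \<open>Z\<close> to \<open>0\<close> on a null set gives a tensor covariation all of whose paths have
  these properties. Its image under the canonical embedding \<open>J\<close> into the bidual is a global
  covariation. Condition (H1) follows from the almost sure convergence of the scalar integrals along
  a subsequence, and (H2) from the fact that a functional \<open>\<phi>\<close> commutes with the Bochner integral, so
  that the integrals of \<open>\<phi>\<close> applied to the tensor integrand are ucp close to \<open>\<phi>(Z)\<close>.

  Identification: let \<open>W\<close> be a global covariation. Limits in ucp are unique, so for each fixed \<open>t\<close> and
  \<open>\<phi>\<close> almost surely \<open>W\<^sub>t(\<phi>) = \<phi>(Z\<^sub>t)\<close>. The exceptional set depends on \<open>\<phi>\<close>, and the dual space may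
  be nonseparable; but \<open>W\<^sub>t - J Z\<^sub>t\<close> is strongly measurable, hence takes values in a separable subspace
  of the bidual, and countably many \<open>\<phi>\<close> decide whether an element of such a subspace vanishes
  (\<open>strongly_measurable_dual_AE_zero\<close>). This gives \<open>W\<^sub>t = J Z\<^sub>t\<close> almost surely for each \<open>t\<close>, and
  right continuity extends the identity from a countable dense set of times to all of \<open>[0,T]\<close>.
\<close>

section \<open>Strong measurability\<close>

lemma strongly_measurable_simple_function: "simple_function M f \<Longrightarrow> strongly_measurable M f"
  unfolding strongly_measurable_def by (intro exI[of _ "\<lambda>_. f"]) auto

lemma strongly_measurable_compose2:
  assumes "strongly_measurable M f" "strongly_measurable M g"
    and h: "continuous_on UNIV (\<lambda>z. h (fst z) (snd z))"
  shows "strongly_measurable M (\<lambda>x. h (f x) (g x))"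
proof -
  obtain s where s: "\<And>i. simple_function M (s i)" "\<And>x. x \<in> space M \<Longrightarrow> (\<lambda>i. s i x) \<longlonglongrightarrow> f x"
    using assms(1) unfolding strongly_measurable_def by blast
  obtain t where t: "\<And>i. simple_function M (t i)" "\<And>x. x \<in> space M \<Longrightarrow> (\<lambda>i. t i x) \<longlonglongrightarrow> g x"
    using assms(2) unfolding strongly_measurable_def by blast
  have "(\<lambda>i. h (s i x) (t i x)) \<longlonglongrightarrow> h (f x) (g x)" if "x \<in> space M" for x
    using continuous_on_tendsto_compose[OF h tendsto_Pair[OF s(2) t(2)], OF that that] by simp
  then show ?thesis
    unfolding strongly_measurable_def
    by (intro exI[of _ "\<lambda>i x. h (s i x) (t i x)"]) (auto intro: simple_function_compose2 s t)
qed

lemma strongly_measurable_compose: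
  assumes "strongly_measurable M f" "continuous_on UNIV h"
  shows "strongly_measurable M (\<lambda>x. h (f x))"
proof -
  have "continuous_on UNIV (\<lambda>z :: 'b \<times> 'b. h (fst z))"
    using continuous_on_compose[OF continuous_on_fst[OF continuous_on_id], of UNIV h]
      continuous_on_subset[OF assms(2)] by (auto simp: o_def)
  then show ?thesis using strongly_measurable_compose2[OF assms(1,1), of "\<lambda>x _. h x"] by simp
qed

lemma strongly_measurable_diff:
  fixes f g :: "'c \<Rightarrow> 'd::real_normed_vector"
  shows "strongly_measurable M f \<Longrightarrow> strongly_measurable M g \<Longrightarrow> strongly_measurable M (\<lambda>x. f x - g x)"
  by (rule strongly_measurable_compose2[where h = "(-)"]) (auto intro!: continuous_intros)

lemma strongly_measurable_imp_borel_measurable: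
  fixes f :: "'c \<Rightarrow> real"
  assumes "strongly_measurable M f"
  shows "f \<in> borel_measurable M"
proof -
  obtain s where s: "\<And>i. simple_function M (s i)" "\<And>x. x \<in> space M \<Longrightarrow> (\<lambda>i. s i x) \<longlonglongrightarrow> f x"
    using assms unfolding strongly_measurable_def by blast
  show ?thesis
    by (rule borel_measurable_LIMSEQ_real[of _ s])
      (auto intro: s borel_measurable_simple_function)
qed

lemma borel_measurable_norm_strongly_measurable:
  fixes f :: "'c \<Rightarrow> 'd::real_normed_vector"
  assumes "strongly_measurable M f"
  shows "(\<lambda>x. norm (f x)) \<in> borel_measurable M"
  by (rule strongly_measurable_imp_borel_measurable, rule strongly_measurable_compose[OF assms])
    (auto intro!: continuous_intros)

lemma strongly_measurable_indicator:
  fixes f :: "'c \<Rightarrow> 'd::real_normed_vector"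
  assumes "strongly_measurable M f" "A \<in> sets M"
  shows "strongly_measurable M (\<lambda>x. indicator A x *\<^sub>R f x)"
  by (rule strongly_measurable_compose2[where h = "scaleR" and f = "indicator A"])
    (auto intro!: continuous_intros assms strongly_measurable_simple_function)

text \<open>A jointly strongly measurable process is strongly measurable at each fixed time, because a section
  of a simple function takes finitely many values on measurable sets. This is what makes almost sure
  statements at a fixed time accessible.\<close>

lemma strongly_measurable_section:
  assumes "strongly_measurable (N \<Otimes>\<^sub>M M) (\<lambda>(t, \<omega>). X t \<omega>)" "t \<in> space N"
  shows "strongly_measurable M (X t)"
proof -
  obtain s where s: "\<And>i. simple_function (N \<Otimes>\<^sub>M M) (s i)"
    "\<And>x. x \<in> space (N \<Otimes>\<^sub>M M) \<Longrightarrow> (\<lambda>i. s i x) \<longlonglongrightarrow> (case x of (t, \<omega>) \<Rightarrow> X t \<omega>)"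
    using assms unfolding strongly_measurable_def by blast
  have "simple_function M (\<lambda>\<omega>. s i (t, \<omega>))" for i
  proof -
    have "finite ((\<lambda>\<omega>. s i (t, \<omega>)) ` space M)"
    proof (rule finite_subset)
      show "(\<lambda>\<omega>. s i (t, \<omega>)) ` space M \<subseteq> s i ` space (N \<Otimes>\<^sub>M M)"
        using assms(2) by (auto simp: space_pair_measure)
      show "finite (s i ` space (N \<Otimes>\<^sub>M M))" using s(1)[of i] by (simp add: simple_function_def)
    qed
    moreover have "(\<lambda>\<omega>. s i (t, \<omega>)) \<in> M \<rightarrow>\<^sub>M count_space UNIV"
      using measurable_compose[OF measurable_Pair1'[OF assms(2)] measurable_simple_function[OF s(1)]] .
    ultimately show ?thesis by (simp add: simple_function_eq_measurable)
  qed
  moreover have "(\<lambda>i. s i (t, \<omega>)) \<longlonglongrightarrow> X t \<omega>" if "\<omega> \<in> space M" for \<omega>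
    using s(2)[of "(t, \<omega>)"] assms(2) that by (simp add: space_pair_measure)
  ultimately show ?thesis
    unfolding strongly_measurable_def by (intro exI[of _ "\<lambda>i \<omega>. s i (t, \<omega>)"]) auto
qed

text \<open>The norm of a functional is by definition a supremum over the unit ball; the factor \<open>2\<close> makes up
  for this supremum possibly not being attained.\<close>

lemma half_norming_vector:
  fixes c :: "'d::real_normed_vector \<Rightarrow>\<^sub>L real"
  shows "\<exists>\<phi>. norm \<phi> \<le> 1 \<and> norm c \<le> 2 * \<bar>blinfun_apply c \<phi>\<bar>"
proof (cases "c = 0")
  case False
  have "\<exists>\<phi>. \<not> norm (blinfun_apply c \<phi>) \<le> norm c / 2 * norm \<phi>"
  proof (rule ccontr)
    assume "\<not> ?thesis"
    then have "norm c \<le> norm c / 2" by (intro norm_blinfun_bound) auto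
    with False show False by simp
  qed
  then obtain \<phi> where \<phi>: "norm c / 2 * norm \<phi> < \<bar>blinfun_apply c \<phi>\<bar>"
    by (auto simp: not_le)
  then have "\<phi> \<noteq> 0" by auto
  with \<phi> show ?thesis
    by (intro exI[of _ "inverse (norm \<phi>) *\<^sub>R \<phi>"])
      (simp add: blinfun.scaleR_right abs_mult field_simps)
qed (auto intro: exI[of _ 0])

text \<open>The exceptional set in \<open>zero\<close> depends on \<open>\<phi>\<close>. It suffices to test with one half-norming vector
  for each of the countably many values of the simple functions approximating \<open>D\<close>: such a value \<open>c\<close>
  satisfies \<open>\<parallel>c\<parallel> \<le> 2 \<parallel>c - D \<omega>\<parallel>\<close> as soon as \<open>D \<omega>\<close> vanishes on the vector chosen for \<open>c\<close>, and letting
  \<open>c\<close> tend to \<open>D \<omega>\<close> leaves no room for \<open>D \<omega> \<noteq> 0\<close>.\<close>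

lemma strongly_measurable_dual_AE_zero:
  fixes D :: "'w \<Rightarrow> ('d::real_normed_vector \<Rightarrow>\<^sub>L real)"
  assumes "strongly_measurable M D" and zero: "\<And>\<phi>. AE \<omega> in M. blinfun_apply (D \<omega>) \<phi> = 0"
  shows "AE \<omega> in M. D \<omega> = 0"
proof -
  obtain s where s: "\<And>i. simple_function M (s i)" "\<And>x. x \<in> space M \<Longrightarrow> (\<lambda>i. s i x) \<longlonglongrightarrow> D x"
    using assms unfolding strongly_measurable_def by blast
  obtain \<psi> where \<psi>: "\<And>c :: 'd \<Rightarrow>\<^sub>L real. norm (\<psi> c) \<le> 1"
    "\<And>c. norm c \<le> 2 * \<bar>blinfun_apply c (\<psi> c)\<bar>"
    using half_norming_vector by metis
  define C where "C = (\<Union>i. s i ` space M)"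
  have "countable C"
    unfolding C_def using s(1) by (auto simp: simple_function_def intro: countable_finite)
  then have "AE \<omega> in M. \<forall>c\<in>C. blinfun_apply (D \<omega>) (\<psi> c) = 0"
    using zero by (simp add: AE_ball_countable)
  then show ?thesis
    using AE_space
  proof eventually_elim
    case (elim \<omega>)
    show ?case
    proof -
      have le: "norm (s i \<omega>) \<le> 2 * norm (s i \<omega> - D \<omega>)" for i
      proof -
        let ?c = "s i \<omega>"
        have "?c \<in> C" using elim(2) by (auto simp: C_def)
        then have "\<bar>blinfun_apply ?c (\<psi> ?c)\<bar> = norm (blinfun_apply (?c - D \<omega>) (\<psi> ?c))"
          using elim(1) by (simp add: blinfun.diff_left)
        also have "\<dots> \<le> norm (?c - D \<omega>) * norm (\<psi> ?c)" by (rule norm_blinfun)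
        also have "\<dots> \<le> norm (?c - D \<omega>)" using \<psi>(1) by (simp add: mult_left_le)
        finally show ?thesis using \<psi>(2)[of ?c] by simp
      qed
      have lim: "(\<lambda>i. s i \<omega>) \<longlonglongrightarrow> D \<omega>" using s(2) elim(2) .
      have "norm (D \<omega>) \<le> 2 * norm (D \<omega> - D \<omega>)"
        by (rule LIMSEQ_le[OF tendsto_norm[OF lim] tendsto_mult[OF tendsto_const tendsto_norm[OF tendsto_diff[OF lim tendsto_const]]]])
          (use le in auto)
      then show ?thesis by simp
    qed
  qed
qed

section \<open>The Bochner integral\<close>

lemma ennreal_tendsto_zero_le:
  fixes a b :: "nat \<Rightarrow> ennreal"
  assumes "\<And>i. a i \<le> b i" "b \<longlonglongrightarrow> 0"
  shows "a \<longlonglongrightarrow> 0"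
  by (rule tendsto_sandwich[OF _ _ tendsto_const assms(2)]) (use assms(1) in auto)

text \<open>Uniqueness of the integral, its norm bound and the Cauchy property of approximating integrals
  all come from this estimate, in which \<open>f\<close> is the intermediate point of a triangle inequality.\<close>

lemma simple_bochner_integral_dist_le:
  fixes f :: "'c \<Rightarrow> 'd::real_normed_vector"
  assumes f: "strongly_measurable M f"
    and s: "Bochner_Integration.simple_bochner_integrable M s"
    and t: "Bochner_Integration.simple_bochner_integrable M t"
  shows "ennreal (norm (Bochner_Integration.simple_bochner_integral M s - Bochner_Integration.simple_bochner_integral M t))
    \<le> (\<integral>\<^sup>+x. ennreal (norm (f x - s x)) \<partial>M) + (\<integral>\<^sup>+x. ennreal (norm (f x - t x)) \<partial>M)"
proof -
  have meas: "(\<lambda>x. norm (f x - s x)) \<in> borel_measurable M" "(\<lambda>x. norm (f x - t x)) \<in> borel_measurable M"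
    using s t by (auto intro!: borel_measurable_norm_strongly_measurable strongly_measurable_diff[OF f]
        intro: strongly_measurable_simple_function elim!: simple_bochner_integrable.cases)
  have "ennreal (norm (Bochner_Integration.simple_bochner_integral M s - Bochner_Integration.simple_bochner_integral M t))
      = ennreal (norm (Bochner_Integration.simple_bochner_integral M (\<lambda>x. s x - t x)))"
    using s t by (subst simple_bochner_integral_diff) auto
  also have "\<dots> \<le> ennreal (Bochner_Integration.simple_bochner_integral M (\<lambda>x. norm (s x - t x)))"
    using simple_bochner_integrable_compose2[of "(-)" M s t] s t
    by (auto intro!: simple_bochner_integral_norm_bound ennreal_leI)
  also have "\<dots> = (\<integral>\<^sup>+x. ennreal (norm (s x - t x)) \<partial>M)"
    using simple_bochner_integrable_compose2[of "\<lambda>x y. norm (x - y)" M s t] s t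
    by (auto intro!: simple_bochner_integral_eq_nn_integral)
  also have "\<dots> \<le> (\<integral>\<^sup>+x. ennreal (norm (f x - s x)) + ennreal (norm (f x - t x)) \<partial>M)"
  proof (rule nn_integral_mono)
    fix x
    have "norm (s x - t x) \<le> norm (f x - s x) + norm (f x - t x)"
      by (metis dual_order.refl norm_diff_triangle_le norm_minus_commute)
    then show "ennreal (norm (s x - t x)) \<le> ennreal (norm (f x - s x)) + ennreal (norm (f x - t x))"
      by (metis ennreal_leI ennreal_plus norm_ge_zero)
  qed
  also have "\<dots> = (\<integral>\<^sup>+x. ennreal (norm (f x - s x)) \<partial>M) + (\<integral>\<^sup>+x. ennreal (norm (f x - t x)) \<partial>M)"
    using meas by (intro nn_integral_add) auto
  finally show ?thesis .
qed

lemma bochner_has_integral_unique: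
  assumes "bochner_has_integral M f I" "bochner_has_integral M f J"
  shows "I = J"
proof -
  note f = assms(1)[unfolded bochner_has_integral_def, THEN conjunct1]
  obtain s where s: "\<And>i. Bochner_Integration.simple_bochner_integrable M (s i)"
    "(\<lambda>i. \<integral>\<^sup>+x. ennreal (norm (f x - s i x)) \<partial>M) \<longlonglongrightarrow> 0"
    "(\<lambda>i. Bochner_Integration.simple_bochner_integral M (s i)) \<longlonglongrightarrow> I"
    using assms(1) unfolding bochner_has_integral_def by blast
  obtain t where t: "\<And>i. Bochner_Integration.simple_bochner_integrable M (t i)"
    "(\<lambda>i. \<integral>\<^sup>+x. ennreal (norm (f x - t i x)) \<partial>M) \<longlonglongrightarrow> 0"
    "(\<lambda>i. Bochner_Integration.simple_bochner_integral M (t i)) \<longlonglongrightarrow> J"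
    using assms(2) unfolding bochner_has_integral_def by blast
  have "ennreal (norm (I - J)) \<le> 0 + 0"
    by (rule LIMSEQ_le[OF tendsto_ennrealI[OF tendsto_norm[OF tendsto_diff[OF s(3) t(3)]]] tendsto_add[OF s(2) t(2)]])
      (use simple_bochner_integral_dist_le[OF f s(1) t(1)] in auto)
  then show ?thesis by simp
qed

lemma bochner_integral_eqI: "bochner_has_integral M f I \<Longrightarrow> bochner_integral M f = I"
  unfolding bochner_integral_def by (blast intro: bochner_has_integral_unique)

lemma bochner_integrable_has_integral:
  "bochner_integrable M f \<Longrightarrow> bochner_has_integral M f (bochner_integral M f)"
  unfolding bochner_integrable_def using bochner_integral_eqI by metis

lemma bochner_has_integral_norm_le:
  assumes "bochner_has_integral M f I"
  shows "ennreal (norm I) \<le> (\<integral>\<^sup>+x. ennreal (norm (f x)) \<partial>M)"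
proof -
  note f = assms(1)[unfolded bochner_has_integral_def, THEN conjunct1]
  obtain s where s: "\<And>i. Bochner_Integration.simple_bochner_integrable M (s i)"
    "(\<lambda>i. \<integral>\<^sup>+x. ennreal (norm (f x - s i x)) \<partial>M) \<longlonglongrightarrow> 0"
    "(\<lambda>i. Bochner_Integration.simple_bochner_integral M (s i)) \<longlonglongrightarrow> I"
    using assms(1) unfolding bochner_has_integral_def by blast
  have zero: "Bochner_Integration.simple_bochner_integrable M (\<lambda>_. 0 :: 'b)"
    "Bochner_Integration.simple_bochner_integral M (\<lambda>_. 0 :: 'b) = 0"
    by (auto simp: simple_bochner_integrable.simps simple_bochner_integral_def image_constant_conv)
  have "ennreal (norm I) \<le> 0 + (\<integral>\<^sup>+x. ennreal (norm (f x)) \<partial>M)"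
    by (rule LIMSEQ_le[OF tendsto_ennrealI[OF tendsto_norm[OF s(3)]] tendsto_add[OF s(2) tendsto_const]])
      (use simple_bochner_integral_dist_le[OF f s(1) zero(1)] zero(2) in auto)
  then show ?thesis by simp
qed

lemma bochner_has_integral_diff:
  assumes "bochner_has_integral M f I" "bochner_has_integral M g J"
  shows "bochner_has_integral M (\<lambda>x. f x - g x) (I - J)"
proof -
  note f = assms(1)[unfolded bochner_has_integral_def, THEN conjunct1]
  note g = assms(2)[unfolded bochner_has_integral_def, THEN conjunct1]
  obtain s where s: "\<And>i. Bochner_Integration.simple_bochner_integrable M (s i)"
    "(\<lambda>i. \<integral>\<^sup>+x. ennreal (norm (f x - s i x)) \<partial>M) \<longlonglongrightarrow> 0"
    "(\<lambda>i. Bochner_Integration.simple_bochner_integral M (s i)) \<longlonglongrightarrow> I"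
    using assms(1) unfolding bochner_has_integral_def by blast
  obtain t where t: "\<And>i. Bochner_Integration.simple_bochner_integrable M (t i)"
    "(\<lambda>i. \<integral>\<^sup>+x. ennreal (norm (g x - t i x)) \<partial>M) \<longlonglongrightarrow> 0"
    "(\<lambda>i. Bochner_Integration.simple_bochner_integral M (t i)) \<longlonglongrightarrow> J"
    using assms(2) unfolding bochner_has_integral_def by blast
  have sf: "strongly_measurable M (s i)" "strongly_measurable M (t i)" for i
    using s(1)[of i] t(1)[of i]
    by (auto intro: strongly_measurable_simple_function elim: simple_bochner_integrable.cases)
  have "(\<integral>\<^sup>+x. ennreal (norm (f x - g x - (s i x - t i x))) \<partial>M)
      \<le> (\<integral>\<^sup>+x. ennreal (norm (f x - s i x)) \<partial>M) + (\<integral>\<^sup>+x. ennreal (norm (g x - t i x)) \<partial>M)" for i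
  proof -
    have "(\<integral>\<^sup>+x. ennreal (norm (f x - g x - (s i x - t i x))) \<partial>M)
        \<le> (\<integral>\<^sup>+x. ennreal (norm (f x - s i x)) + ennreal (norm (g x - t i x)) \<partial>M)"
    proof (rule nn_integral_mono)
      fix x
      have "f x - g x - (s i x - t i x) = (f x - s i x) - (g x - t i x)" by simp
      then have "norm (f x - g x - (s i x - t i x)) \<le> norm (f x - s i x) + norm (g x - t i x)"
        using norm_triangle_ineq4 by metis
      then show "ennreal (norm (f x - g x - (s i x - t i x)))
          \<le> ennreal (norm (f x - s i x)) + ennreal (norm (g x - t i x))"
        by (metis ennreal_leI ennreal_plus norm_ge_zero)
    qed
    also have "\<dots> = (\<integral>\<^sup>+x. ennreal (norm (f x - s i x)) \<partial>M) + (\<integral>\<^sup>+x. ennreal (norm (g x - t i x)) \<partial>M)"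
      using borel_measurable_norm_strongly_measurable[OF strongly_measurable_diff[OF f sf(1)[of i]]]
        borel_measurable_norm_strongly_measurable[OF strongly_measurable_diff[OF g sf(2)[of i]]]
      by (intro nn_integral_add) auto
    finally show ?thesis .
  qed
  moreover have "(\<lambda>i. (\<integral>\<^sup>+x. ennreal (norm (f x - s i x)) \<partial>M) + (\<integral>\<^sup>+x. ennreal (norm (g x - t i x)) \<partial>M))
      \<longlonglongrightarrow> 0"
    using tendsto_add[OF s(2) t(2)] by simp
  ultimately have "(\<lambda>i. \<integral>\<^sup>+x. ennreal (norm (f x - g x - (s i x - t i x))) \<partial>M) \<longlonglongrightarrow> 0"
    by (rule ennreal_tendsto_zero_le)
  moreover have "(\<lambda>i. Bochner_Integration.simple_bochner_integral M (\<lambda>x. s i x - t i x)) \<longlonglongrightarrow> I - J"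
    using tendsto_diff[OF s(3) t(3)] s(1) t(1) by (simp add: simple_bochner_integral_diff)
  moreover have "Bochner_Integration.simple_bochner_integrable M (\<lambda>x. s i x - t i x)" for i
    using simple_bochner_integrable_compose2[of "(-)" M "s i" "t i"] s(1) t(1) by auto
  ultimately show ?thesis
    unfolding bochner_has_integral_def
    by (intro conjI strongly_measurable_diff[OF f g] exI[of _ "\<lambda>i x. s i x - t i x"]) auto
qed

text \<open>Cutting off the approximating simple functions does not increase their distance to the cut-off
  integrand, so their integrals form a Cauchy sequence; its limit exists because the range is
  complete.\<close>

lemma bochner_integrable_indicator:
  fixes f :: "'c \<Rightarrow> 'd::banach"
  assumes "bochner_integrable M f" "A \<in> sets M"
  shows "bochner_integrable M (\<lambda>x. indicator A x *\<^sub>R f x)"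
proof -
  obtain I s where f: "strongly_measurable M f"
    and s: "\<And>i. Bochner_Integration.simple_bochner_integrable M (s i)"
    and lim: "(\<lambda>i. \<integral>\<^sup>+x. ennreal (norm (f x - s i x)) \<partial>M) \<longlonglongrightarrow> 0"
    using assms(1) unfolding bochner_integrable_def bochner_has_integral_def by blast
  define g t where "g = (\<lambda>x. indicator A x *\<^sub>R f x)" and "t = (\<lambda>i x. indicator A x *\<^sub>R s i x)"
  have g: "strongly_measurable M g"
    unfolding g_def using f assms(2) by (rule strongly_measurable_indicator)
  have t: "Bochner_Integration.simple_bochner_integrable M (t i)" for i
  proof
    have s': "simple_function M (s i)" "emeasure M {y \<in> space M. s i y \<noteq> 0} \<noteq> \<infinity>"
      using s[of i] by (auto elim: simple_bochner_integrable.cases)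
    show sf: "simple_function M (t i)"
      unfolding t_def using assms(2) s'(1) by (intro simple_function_compose2[where h = scaleR]) auto
    have "{y \<in> space M. s i y \<noteq> 0} \<in> sets M"
      using measurable_simple_function[OF s'(1)] by measurable
    then have "emeasure M {y \<in> space M. t i y \<noteq> 0} \<le> emeasure M {y \<in> space M. s i y \<noteq> 0}"
      by (intro emeasure_mono) (auto simp: t_def)
    then show "emeasure M {y \<in> space M. t i y \<noteq> 0} \<noteq> \<infinity>"
      using s'(2) by (auto simp: top_unique)
  qed
  have "(\<integral>\<^sup>+x. ennreal (norm (g x - t i x)) \<partial>M) \<le> (\<integral>\<^sup>+x. ennreal (norm (f x - s i x)) \<partial>M)" for i
    by (intro nn_integral_mono) (auto simp: g_def t_def split: split_indicator)
  then have lim': "(\<lambda>i. \<integral>\<^sup>+x. ennreal (norm (g x - t i x)) \<partial>M) \<longlonglongrightarrow> 0"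
    by (rule ennreal_tendsto_zero_le[OF _ lim])
  have "Cauchy (\<lambda>i. Bochner_Integration.simple_bochner_integral M (t i))"
  proof (rule CauchyI)
    fix e :: real assume "0 < e"
    then have "\<forall>\<^sub>F i in sequentially. (\<integral>\<^sup>+x. ennreal (norm (g x - t i x)) \<partial>M) < ennreal (e / 2)"
      using order_tendstoD(2)[OF lim'] by simp
    then obtain N where N: "\<And>i. i \<ge> N \<Longrightarrow> (\<integral>\<^sup>+x. ennreal (norm (g x - t i x)) \<partial>M) < ennreal (e / 2)"
      unfolding eventually_sequentially by blast
    have "norm (Bochner_Integration.simple_bochner_integral M (t m) - Bochner_Integration.simple_bochner_integral M (t n)) < e"
      if "m \<ge> N" "n \<ge> N" for m n
    proof -
      have "ennreal (norm (Bochner_Integration.simple_bochner_integral M (t m) - Bochner_Integration.simple_bochner_integral M (t n)))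
          \<le> (\<integral>\<^sup>+x. ennreal (norm (g x - t m x)) \<partial>M) + (\<integral>\<^sup>+x. ennreal (norm (g x - t n x)) \<partial>M)"
        by (rule simple_bochner_integral_dist_le[OF g t t])
      also have "\<dots> < ennreal (e / 2) + ennreal (e / 2)"
        by (rule add_strict_mono) (use N that in auto)
      also have "\<dots> = ennreal e" using \<open>0 < e\<close> by (simp flip: ennreal_plus)
      finally show ?thesis by (simp add: ennreal_less_iff)
    qed
    then show "\<exists>N. \<forall>m\<ge>N. \<forall>n\<ge>N. norm (Bochner_Integration.simple_bochner_integral M (t m) - Bochner_Integration.simple_bochner_integral M (t n)) < e"
      by blast
  qed
  then obtain J where "(\<lambda>i. Bochner_Integration.simple_bochner_integral M (t i)) \<longlonglongrightarrow> J"
    using Cauchy_convergent convergent_def by blast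
  then show ?thesis
    unfolding bochner_integrable_def bochner_has_integral_def g_def[symmetric]
    using g t lim' by blast
qed

text \<open>Commuting a functional with the integral leads from the Bochner integral to the Lebesgue integrals
  of real functions in which (H2) is formulated.\<close>

lemma bochner_has_integral_blinfun:
  fixes f :: "'c \<Rightarrow> 'd::real_normed_vector" and \<phi> :: "'d \<Rightarrow>\<^sub>L real"
  assumes "bochner_has_integral M f I"
  shows "has_bochner_integral M (\<lambda>x. blinfun_apply \<phi> (f x)) (blinfun_apply \<phi> I)"
proof -
  obtain s where f: "strongly_measurable M f"
    and s: "\<And>i. Bochner_Integration.simple_bochner_integrable M (s i)"
    "(\<lambda>i. \<integral>\<^sup>+x. ennreal (norm (f x - s i x)) \<partial>M) \<longlonglongrightarrow> 0"
    "(\<lambda>i. Bochner_Integration.simple_bochner_integral M (s i)) \<longlonglongrightarrow> I"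
    using assms(1) unfolding bochner_has_integral_def by blast
  show ?thesis
  proof (rule has_bochner_integral.intros[where s = "\<lambda>i x. blinfun_apply \<phi> (s i x)"])
    show "(\<lambda>x. blinfun_apply \<phi> (f x)) \<in> borel_measurable M"
      by (intro strongly_measurable_imp_borel_measurable
          strongly_measurable_compose[OF f, of "blinfun_apply \<phi>"]
          linear_continuous_on blinfun.bounded_linear_right)
    show "Bochner_Integration.simple_bochner_integrable M (\<lambda>x. blinfun_apply \<phi> (s i x))" for i
      using simple_bochner_integrable_compose2[where p = "\<lambda>x y. blinfun_apply \<phi> x", OF _ s(1) s(1)]
      by (simp add: blinfun.zero_right)
    have "Bochner_Integration.simple_bochner_integral M (\<lambda>x. blinfun_apply \<phi> (s i x))
        = blinfun_apply \<phi> (Bochner_Integration.simple_bochner_integral M (s i))" for i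
      by (rule simple_bochner_integral_linear[OF _ s(1)])
        (simp add: blinfun.bounded_linear_right bounded_linear.linear)
    then show "(\<lambda>i. Bochner_Integration.simple_bochner_integral M (\<lambda>x. blinfun_apply \<phi> (s i x)))
        \<longlonglongrightarrow> blinfun_apply \<phi> I"
      using blinfun.tendsto[OF tendsto_const s(3), of \<phi>] by simp
    have "(\<integral>\<^sup>+x. ennreal (norm (blinfun_apply \<phi> (f x) - blinfun_apply \<phi> (s i x))) \<partial>M)
        \<le> ennreal (norm \<phi>) * (\<integral>\<^sup>+x. ennreal (norm (f x - s i x)) \<partial>M)" for i
    proof -
      have "strongly_measurable M (s i)"
        using s(1)[of i] by (auto intro: strongly_measurable_simple_function elim: simple_bochner_integrable.cases)
      then have "(\<lambda>x. norm (f x - s i x)) \<in> borel_measurable M"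
        using f by (intro borel_measurable_norm_strongly_measurable strongly_measurable_diff)
      moreover have "ennreal (norm (blinfun_apply \<phi> (f x) - blinfun_apply \<phi> (s i x)))
          \<le> ennreal (norm \<phi>) * ennreal (norm (f x - s i x))" for x
        using norm_blinfun[of \<phi> "f x - s i x"]
        by (simp add: blinfun.diff_right ennreal_mult[symmetric])
      ultimately show ?thesis
        by (subst nn_integral_cmult[symmetric]) (auto intro!: nn_integral_mono)
    qed
    moreover have "(\<lambda>i. ennreal (norm \<phi>) * (\<integral>\<^sup>+x. ennreal (norm (f x - s i x)) \<partial>M)) \<longlonglongrightarrow> 0"
      using ennreal_tendsto_cmult[OF _ s(2), of "ennreal (norm \<phi>)"] by simp
    ultimately show "(\<lambda>i. \<integral>\<^sup>+x. ennreal (norm (blinfun_apply \<phi> (f x) - blinfun_apply \<phi> (s i x))) \<partial>M) \<longlonglongrightarrow> 0"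
      by (rule ennreal_tendsto_zero_le)
  qed
qed

section \<open>Convergence uniformly in probability\<close>

lemma outer_measure_of_Un_le:
  assumes "A \<subseteq> space M" "B \<subseteq> space M"
  shows "outer_measure_of M (A \<union> B) \<le> outer_measure_of M A + outer_measure_of M B"
proof -
  obtain E where E: "E \<in> sets M" "A \<subseteq> E" "outer_measure_of M A = emeasure M E"
    using outer_measure_of_attain[OF assms(1)] by blast
  obtain F where F: "F \<in> sets M" "B \<subseteq> F" "outer_measure_of M B = emeasure M F"
    using outer_measure_of_attain[OF assms(2)] by blast
  have "outer_measure_of M (A \<union> B) \<le> outer_measure_of M (E \<union> F)"
    using E F by (intro outer_measure_of_mono) auto
  also have "\<dots> = emeasure M (E \<union> F)" using E F by simp
  also have "\<dots> \<le> outer_measure_of M A + outer_measure_of M B"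
    unfolding E(3) F(3) using E(1) F(1) by (rule emeasure_subadditive)
  finally show ?thesis .
qed

lemma outer_measure_of_zero_AE:
  assumes "outer_measure_of M A = 0" "A \<subseteq> space M"
  shows "AE x in M. x \<notin> A"
proof -
  obtain E where "E \<in> sets M" "A \<subseteq> E" "outer_measure_of M A = emeasure M E"
    using outer_measure_of_attain[OF assms(2)] by blast
  then show ?thesis using assms(1) by (intro AE_I'[of E]) auto
qed

abbreviation ucp_deviation ::
    "'w measure \<Rightarrow> real \<Rightarrow> real \<Rightarrow> (real \<Rightarrow> 'w \<Rightarrow> 'd::real_normed_vector) \<Rightarrow> (real \<Rightarrow> 'w \<Rightarrow> 'd) \<Rightarrow> 'w set" where
  "ucp_deviation M T \<delta> f g \<equiv> {\<omega>\<in>space M. \<exists>t\<in>{0..T}. \<delta> < norm (f t \<omega> - g t \<omega>)}"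

lemma ucp_converges_unique:
  assumes "ucp_converges M T F L" "ucp_converges M T F L'"
  shows "AE \<omega> in M. \<forall>t\<in>{0..T}. L t \<omega> = L' t \<omega>"
proof -
  have "AE \<omega> in M. \<omega> \<notin> ucp_deviation M T \<delta> L L'" if "\<delta> > 0" for \<delta>
  proof (rule outer_measure_of_zero_AE)
    let ?a = "\<lambda>\<epsilon>. outer_measure_of M (ucp_deviation M T (\<delta> / 2) (F \<epsilon>) L)"
    let ?b = "\<lambda>\<epsilon>. outer_measure_of M (ucp_deviation M T (\<delta> / 2) (F \<epsilon>) L')"
    have lim: "((\<lambda>\<epsilon>. ?a \<epsilon> + ?b \<epsilon>) \<longlongrightarrow> 0 + 0) (at_right 0)"
      using assms half_gt_zero[OF that] unfolding ucp_converges_def by (intro tendsto_add) blast+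
    have "outer_measure_of M (ucp_deviation M T \<delta> L L') \<le> ?a \<epsilon> + ?b \<epsilon>" for \<epsilon>
    proof -
      have "ucp_deviation M T \<delta> L L'
          \<subseteq> ucp_deviation M T (\<delta> / 2) (F \<epsilon>) L \<union> ucp_deviation M T (\<delta> / 2) (F \<epsilon>) L'"
      proof safe
        fix \<omega> t assume *: "\<omega> \<in> space M" "t \<in> {0..T}" "\<delta> < norm (L t \<omega> - L' t \<omega>)"
          and "\<not> (\<exists>t\<in>{0..T}. \<delta> / 2 < norm (F \<epsilon> t \<omega> - L' t \<omega>))"
        then have "norm (F \<epsilon> t \<omega> - L' t \<omega>) \<le> \<delta> / 2" by (meson not_le)
        moreover have "norm (L t \<omega> - L' t \<omega>) \<le> norm (F \<epsilon> t \<omega> - L t \<omega>) + norm (F \<epsilon> t \<omega> - L' t \<omega>)"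
          by (metis dual_order.refl norm_diff_triangle_le norm_minus_commute)
        ultimately show "\<exists>t\<in>{0..T}. \<delta> / 2 < norm (F \<epsilon> t \<omega> - L t \<omega>)"
          using * by (intro bexI[of _ t]) auto
      qed
      then have "outer_measure_of M (ucp_deviation M T \<delta> L L')
          \<le> outer_measure_of M (ucp_deviation M T (\<delta> / 2) (F \<epsilon>) L \<union> ucp_deviation M T (\<delta> / 2) (F \<epsilon>) L')"
        by (rule outer_measure_of_mono)
      also have "\<dots> \<le> ?a \<epsilon> + ?b \<epsilon>" by (rule outer_measure_of_Un_le) auto
      finally show ?thesis .
    qed
    then have "outer_measure_of M (ucp_deviation M T \<delta> L L') \<le> 0 + 0"
      by (intro tendsto_lowerbound[OF lim]) auto
    then show "outer_measure_of M (ucp_deviation M T \<delta> L L') = 0" by simp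
  qed auto
  then have "AE \<omega> in M. \<forall>n. \<omega> \<notin> ucp_deviation M T (inverse (real (Suc n))) L L'"
    by (simp add: AE_all_countable del: of_nat_Suc)
  then show ?thesis
    using AE_space
  proof eventually_elim
    case (elim \<omega>)
    show ?case
    proof (rule ballI, rule ccontr)
      fix t assume t: "t \<in> {0..T}" "L t \<omega> \<noteq> L' t \<omega>"
      then obtain n where "inverse (real (Suc n)) < norm (L t \<omega> - L' t \<omega>)"
        using reals_Archimedean[of "norm (L t \<omega> - L' t \<omega>)"] by auto
      then show False using elim t by (auto simp del: of_nat_Suc)
    qed
  qed
qed

text \<open>Used with \<open>K = 1\<close> to change a limit on a null set, and with \<open>K = \<parallel>\<phi>\<parallel>\<close> to pass from the tensor
  integrals to their images under a functional \<open>\<phi>\<close>.\<close>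

lemma ucp_converges_dominated:
  assumes F: "ucp_converges M T F L" and "0 \<le> K"
    and le: "\<And>\<epsilon>. \<epsilon> > 0 \<Longrightarrow>
      AE \<omega> in M. \<forall>t\<in>{0..T}. norm (F' \<epsilon> t \<omega> - L' t \<omega>) \<le> K * norm (F \<epsilon> t \<omega> - L t \<omega>)"
  shows "ucp_converges M T F' L'"
  unfolding ucp_converges_def
proof (intro allI impI)
  fix \<delta> :: real assume "\<delta> > 0"
  let ?\<delta> = "\<delta> / (K + 1)"
  have "?\<delta> > 0" using \<open>\<delta> > 0\<close> \<open>0 \<le> K\<close> by simp
  have "outer_measure_of M (ucp_deviation M T \<delta> (F' \<epsilon>) L')
      \<le> outer_measure_of M (ucp_deviation M T ?\<delta> (F \<epsilon>) L)" if "\<epsilon> > 0" for \<epsilon>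
  proof -
    note AE = le[OF that]
    obtain N where N: "{\<omega> \<in> space M. \<not> (\<forall>t\<in>{0..T}. norm (F' \<epsilon> t \<omega> - L' t \<omega>) \<le> K * norm (F \<epsilon> t \<omega> - L t \<omega>))} \<subseteq> N"
      "emeasure M N = 0" "N \<in> sets M"
      using AE_E[OF AE] by blast
    have "ucp_deviation M T \<delta> (F' \<epsilon>) L' \<subseteq> ucp_deviation M T ?\<delta> (F \<epsilon>) L \<union> N"
    proof safe
      fix \<omega> t assume *: "\<omega> \<in> space M" "t \<in> {0..T}" "\<delta> < norm (F' \<epsilon> t \<omega> - L' t \<omega>)" "\<omega> \<notin> N"
      then have "norm (F' \<epsilon> t \<omega> - L' t \<omega>) \<le> K * norm (F \<epsilon> t \<omega> - L t \<omega>)" using N(1) by blast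
      also have "\<dots> \<le> (K + 1) * norm (F \<epsilon> t \<omega> - L t \<omega>)" by (simp add: mult_right_mono)
      finally have "?\<delta> < norm (F \<epsilon> t \<omega> - L t \<omega>)"
        using *(3) \<open>0 \<le> K\<close> by (simp add: pos_divide_less_eq mult.commute)
      then show "\<exists>t\<in>{0..T}. ?\<delta> < norm (F \<epsilon> t \<omega> - L t \<omega>)" using *(2) by blast
    qed
    then have "outer_measure_of M (ucp_deviation M T \<delta> (F' \<epsilon>) L')
        \<le> outer_measure_of M (ucp_deviation M T ?\<delta> (F \<epsilon>) L \<union> N)"
      by (rule outer_measure_of_mono)
    also have "\<dots> \<le> outer_measure_of M (ucp_deviation M T ?\<delta> (F \<epsilon>) L) + outer_measure_of M N"
      by (rule outer_measure_of_Un_le) (use sets.sets_into_space[OF N(3)] in auto)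
    finally show ?thesis using N(2,3) by simp
  qed
  then have "\<forall>\<^sub>F \<epsilon> in at_right 0. outer_measure_of M (ucp_deviation M T \<delta> (F' \<epsilon>) L')
      \<le> outer_measure_of M (ucp_deviation M T ?\<delta> (F \<epsilon>) L)"
    by (rule eventually_mono[OF eventually_at_right_less])
  moreover have "((\<lambda>\<epsilon>. outer_measure_of M (ucp_deviation M T ?\<delta> (F \<epsilon>) L)) \<longlongrightarrow> 0) (at_right 0)"
    using F \<open>?\<delta> > 0\<close> unfolding ucp_converges_def by blast
  ultimately show "((\<lambda>\<epsilon>. outer_measure_of M (ucp_deviation M T \<delta> (F' \<epsilon>) L')) \<longlongrightarrow> 0) (at_right 0)"
    by (rule tendsto_sandwich[rotated, OF _ tendsto_const]) simp
qed

text \<open>The usual Borel--Cantelli argument. The deviation events need not be measurable, so they are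
  replaced by measurable covers of the same outer measure.\<close>

lemma ucp_converges_AE_subsequence:
  assumes F: "ucp_converges M T F L" and e: "\<And>n. 0 < e n" "e \<longlonglongrightarrow> 0"
  shows "\<exists>r :: nat \<Rightarrow> nat. strict_mono r \<and>
    (AE \<omega> in M. \<forall>t\<in>{0..T}. (\<lambda>k. F (e (r k)) t \<omega>) \<longlonglongrightarrow> L t \<omega>)"
proof -
  let ?p = "\<lambda>k n. outer_measure_of M (ucp_deviation M T ((1/2) ^ k) (F (e n)) L)"
  have "filterlim e (at_right 0) sequentially"
    using e by (auto simp: filterlim_at less_imp_neq[symmetric] intro!: always_eventually)
  then have lim: "?p k \<longlonglongrightarrow> 0" for k
    by (rule filterlim_compose[rotated]) (use F in \<open>simp add: ucp_converges_def\<close>)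
  have small: "\<exists>n>m. ?p k n < ennreal ((1/2) ^ k)" for k m
  proof -
    have "\<forall>\<^sub>F n in sequentially. ?p k n < ennreal ((1/2) ^ k) \<and> m < n"
      using order_tendstoD(2)[OF lim] eventually_gt_at_top[of m] by (intro eventually_conj) auto
    then show ?thesis using eventually_happens'[OF sequentially_bot] by blast
  qed
  have "\<exists>r. \<forall>k. ?p k (r k) < ennreal ((1/2) ^ k) \<and> r k < r (Suc k)"
    by (rule dependent_nat_choice) (use small in blast)+
  then obtain r where r: "\<And>k. ?p k (r k) < ennreal ((1/2) ^ k)" "\<And>k. r k < r (Suc k)" by blast
  have "\<exists>E\<in>sets M. ucp_deviation M T ((1/2) ^ k) (F (e (r k))) L \<subseteq> E \<and> ?p k (r k) = emeasure M E" for k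
    by (rule outer_measure_of_attain) auto
  then have "\<forall>k. \<exists>E. E \<in> sets M \<and> ucp_deviation M T ((1/2) ^ k) (F (e (r k))) L \<subseteq> E \<and> ?p k (r k) = emeasure M E"
    by blast
  from choice[OF this] obtain E where E: "\<And>k. E k \<in> sets M"
    "\<And>k. ucp_deviation M T ((1/2) ^ k) (F (e (r k))) L \<subseteq> E k"
    "\<And>k. ?p k (r k) = emeasure M (E k)" by blast
  have E_less: "emeasure M (E k) < ennreal ((1/2) ^ k)" for k
    using r(1)[of k] unfolding E(3) .
  have "AE \<omega> in M. \<forall>\<^sub>F k in sequentially. \<omega> \<in> space M - E k"
  proof (rule borel_cantelli_AE1)
    show "emeasure M (E k) < \<infinity>" for k
      using E_less[of k] by (rule order.strict_trans) (simp add: ennreal_less_top)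
    show "summable (\<lambda>k. measure M (E k))"
    proof (rule summable_comparison_test)
      show "summable (\<lambda>k. (1/2 :: real) ^ k)" by (rule summable_geometric) simp
      show "\<exists>N. \<forall>k\<ge>N. norm (measure M (E k)) \<le> (1/2) ^ k"
      proof (intro exI allI impI)
        fix k
        have "measure M (E k) \<le> (1/2) ^ k"
          unfolding measure_def by (rule enn2real_leI) (use less_imp_le[OF E_less] in auto)
        then show "norm (measure M (E k)) \<le> (1/2) ^ k" by simp
      qed
    qed
  qed (rule E)
  then have "AE \<omega> in M. \<forall>t\<in>{0..T}. (\<lambda>k. F (e (r k)) t \<omega>) \<longlonglongrightarrow> L t \<omega>"
  proof eventually_elim
    case (elim \<omega>)
    show ?case
    proof
      fix t assume t: "t \<in> {0..T}"
      have "\<forall>\<^sub>F k in sequentially. norm (F (e (r k)) t \<omega> - L t \<omega>) \<le> (1/2) ^ k"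
        using elim
      proof eventually_elim
        case (elim k)
        then have "\<omega> \<notin> ucp_deviation M T ((1/2) ^ k) (F (e (r k))) L" using E(2) by blast
        then have "\<not> (1/2) ^ k < norm (F (e (r k)) t \<omega> - L t \<omega>)" using elim t by blast
        then show ?case by (simp only: not_less)
      qed
      moreover have "(\<lambda>k. (1/2 :: real) ^ k) \<longlonglongrightarrow> 0" by (rule LIMSEQ_power_zero) simp
      ultimately have "(\<lambda>k. F (e (r k)) t \<omega> - L t \<omega>) \<longlonglongrightarrow> 0"
        by (rule Lim_null_comparison)
      then show "(\<lambda>k. F (e (r k)) t \<omega>) \<longlonglongrightarrow> L t \<omega>" by (rule LIM_zero_cancel)
    qed
  qed
  then show ?thesis using r(2) by (intro exI[of _ r]) (simp add: strict_mono_Suc_iff)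
qed

section \<open>Paths dominated by a continuous increasing function\<close>

lemma dominated_increments_continuous_on:
  fixes f :: "real \<Rightarrow> 'd::real_normed_vector"
  assumes le: "\<And>s t. 0 \<le> s \<Longrightarrow> s \<le> t \<Longrightarrow> t \<le> T \<Longrightarrow> norm (f t - f s) \<le> g t - g s"
    and g: "continuous_on {0..T} g"
  shows "continuous_on {0..T} f"
  unfolding continuous_on_def
proof
  fix t assume t: "t \<in> {0..T}"
  have "((\<lambda>s. g s - g t) \<longlongrightarrow> 0) (at t within {0..T})"
    using g t by (auto simp: continuous_on_def intro: LIM_zero)
  then have "((\<lambda>s. \<bar>g s - g t\<bar>) \<longlongrightarrow> 0) (at t within {0..T})" by (rule tendsto_rabs_zero)
  moreover have "norm (f s - f t) \<le> \<bar>g s - g t\<bar>" if "s \<in> {0..T}" for s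
    using le[of s t] le[of t s] that t by (cases "s \<le> t") (auto simp: norm_minus_commute)
  then have "\<forall>\<^sub>F s in at t within {0..T}. norm (f s - f t) \<le> \<bar>g s - g t\<bar>"
    by (auto simp: eventually_at_filter)
  ultimately have "((\<lambda>s. f s - f t) \<longlongrightarrow> 0) (at t within {0..T})"
    by (rule Lim_null_comparison[rotated])
  then show "(f \<longlongrightarrow> f t) (at t within {0..T})" by (rule LIM_zero_cancel)
qed

lemma dominated_increments_bounded_variation_on:
  fixes f :: "real \<Rightarrow> 'd::real_normed_vector"
  assumes le: "\<And>s t. 0 \<le> s \<Longrightarrow> s \<le> t \<Longrightarrow> t \<le> T \<Longrightarrow> norm (f t - f s) \<le> g t - g s"
  shows "bounded_variation_on T f"
  unfolding bounded_variation_on_def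
proof (intro exI[of _ "g T - g 0"] allI impI, elim conjE)
  fix n p assume p: "\<forall>i<n. p i \<le> p (Suc i)" "\<forall>i\<le>n. p i \<in> {0..T}"
  have mono: "g s \<le> g t" if "0 \<le> s" "s \<le> t" "t \<le> T" for s t
    using le[OF that] norm_ge_zero[of "f t - f s"] by linarith
  have "(\<Sum>i<n. norm (f (p (Suc i)) - f (p i))) \<le> (\<Sum>i<n. g (p (Suc i)) - g (p i))"
    using p by (intro sum_mono le) (auto simp: Suc_le_eq)
  also have "\<dots> = g (p n) - g (p 0)" by (rule sum_lessThan_telescope)
  also have "\<dots> \<le> g T - g 0"
    using mono[of "p n" T] mono[of 0 "p 0"] p(2) by (auto intro!: diff_mono)
  finally show "(\<Sum>i<n. norm (f (p (Suc i)) - f (p i))) \<le> g T - g 0" .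
qed

lemma continuous_on_Icc_cadlag_on:
  assumes f: "continuous_on {0..T} f"
  shows "cadlag_on T f"
  unfolding cadlag_on_def
proof (intro conjI ballI exI)
  fix t assume "t \<in> {0..<T}"
  then show "(f \<longlongrightarrow> f t) (at_right t)"
    using continuous_on_subset[OF f, of "{t..T}"] by (intro continuous_on_Icc_at_rightD[of t T]) auto
next
  fix t assume "t \<in> {0<..T}"
  then show "(f \<longlongrightarrow> f t) (at_left t)"
    using continuous_on_subset[OF f, of "{0..t}"] by (intro continuous_on_Icc_at_leftD[of 0 t]) auto
qed

text \<open>Right limits do not reach the end point \<open>T\<close>, which is therefore added to the rationals.\<close>

lemma right_continuous_eqI:
  fixes f g :: "real \<Rightarrow> 'd::real_normed_vector"
  assumes f: "\<And>t. t \<in> {0..<T} \<Longrightarrow> (f \<longlongrightarrow> f t) (at_right t)"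
    and g: "\<And>t. t \<in> {0..<T} \<Longrightarrow> (g \<longlongrightarrow> g t) (at_right t)"
    and eq: "\<And>t. t \<in> (\<rat> \<union> {T}) \<inter> {0..T} \<Longrightarrow> f t = g t"
    and t: "t \<in> {0..T}"
  shows "f t = g t"
proof (cases "t = T")
  case False
  then have t': "t \<in> {0..<T}" using t by auto
  have lim: "((\<lambda>s. norm (f s - g s)) \<longlongrightarrow> norm (f t - g t)) (at_right t)"
    by (intro tendsto_intros f g t')
  show ?thesis
  proof (rule ccontr)
    assume "f t \<noteq> g t"
    then have "\<forall>\<^sub>F s in at_right t. 0 < norm (f s - g s)"
      by (intro order_tendstoD(1)[OF lim]) simp
    then obtain b where b: "b > t" "\<And>s. t < s \<Longrightarrow> s < b \<Longrightarrow> f s \<noteq> g s"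
      unfolding eventually_at_right_field by auto
    obtain q where "q \<in> \<rat>" "t < q" "q < min b T"
      using Rats_dense_in_real[of t "min b T"] b(1) t' by auto
    then show False using b(2)[of q] eq[of q] t' by auto
  qed
qed (use eq t in auto)

section \<open>Projective tensors and the canonical embedding\<close>

lemma norm_tensor_le: "norm (x \<otimes>\<^sub>\<pi> y) \<le> norm x * norm y"
  using projective_norm_le[of "[(x, y)]"]
  by (simp add: tensor_def norm_to_completion seminorm_alg_tensor_def)

lemma canonical_embedding_apply: "blinfun_apply (canonical_embedding x) \<phi> = blinfun_apply \<phi> x"
  by (simp add: canonical_embedding.rep_eq)

lemma norm_canonical_embedding_le: "norm (canonical_embedding x) \<le> norm x"
proof (rule norm_blinfun_bound)
  show "norm (blinfun_apply (canonical_embedding x) \<phi>) \<le> norm x * norm \<phi>" for \<phi>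
    using norm_blinfun[of \<phi> x] by (simp add: canonical_embedding_apply mult.commute)
qed simp

lemma bounded_linear_canonical_embedding: "bounded_linear canonical_embedding"
proof (rule bounded_linear_intro[where K = 1])
  show "norm (canonical_embedding x) \<le> norm x * 1" for x :: 'a
    by (simp add: norm_canonical_embedding_le)
qed (auto intro!: blinfun_eqI simp: canonical_embedding_apply blinfun.add_right blinfun.add_left
    blinfun.scaleR_right blinfun.scaleR_left)

lemma norm_tensor_integrand_le:
  "\<epsilon> > 0 \<Longrightarrow> norm (tensor_integrand T X Y \<epsilon> s \<omega>) \<le> scalar_integrand T X Y \<epsilon> s \<omega>"
  by (simp add: tensor_integrand_def scalar_integrand_def divide_right_mono norm_tensor_le)

section \<open>Indefinite Bochner integrals\<close>

lemma bochner_integrable_initial_segment: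
  fixes f :: "real \<Rightarrow> 'd::banach"
  assumes "bochner_integrable lborel (\<lambda>u. indicator {0..T} u *\<^sub>R f u)" "t \<le> T"
  shows "bochner_integrable lborel (\<lambda>u. indicator {0..t} u *\<^sub>R f u)"
proof -
  have "(\<lambda>u. indicator {0..t} u *\<^sub>R f u) = (\<lambda>u. indicator {0..t} u *\<^sub>R indicator {0..T} u *\<^sub>R f u)"
    using assms(2) by (auto split: split_indicator)
  then show ?thesis using bochner_integrable_indicator[OF assms(1), of "{0..t}"] by simp
qed

lemma bochner_integral_increment_le:
  fixes f :: "real \<Rightarrow> 'd::banach"
  assumes f: "bochner_integrable lborel (\<lambda>u. indicator {0..T} u *\<^sub>R f u)"
    and g: "set_integrable lborel {0..T} g" and le: "\<And>u. norm (f u) \<le> g u"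
    and st: "0 \<le> s" "s \<le> t" "t \<le> T"
  shows "norm (bochner_integral lborel (\<lambda>u. indicator {0..t} u *\<^sub>R f u)
      - bochner_integral lborel (\<lambda>u. indicator {0..s} u *\<^sub>R f u))
    \<le> (LINT u:{0..t}|lborel. g u) - (LINT u:{0..s}|lborel. g u)" (is "norm (?F t - ?F s) \<le> _")
proof -
  have g_nonneg: "0 \<le> g u" for u using le[of u] norm_ge_zero order_trans by blast
  have g_sub: "set_integrable lborel {0..s} g" "set_integrable lborel {s<..t} g"
    using st by (auto intro: set_integrable_subset[OF g])
  have int: "bochner_has_integral lborel (\<lambda>u. indicator {0..r} u *\<^sub>R f u) (?F r)" if "r \<le> T" for r
    by (intro bochner_integrable_has_integral bochner_integrable_initial_segment[OF f that])
  have "bochner_has_integral lborel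
      (\<lambda>u. indicator {0..t} u *\<^sub>R f u - indicator {0..s} u *\<^sub>R f u) (?F t - ?F s)"
    using st by (intro bochner_has_integral_diff int) auto
  then have "ennreal (norm (?F t - ?F s))
      \<le> (\<integral>\<^sup>+u. ennreal (norm (indicator {0..t} u *\<^sub>R f u - indicator {0..s} u *\<^sub>R f u)) \<partial>lborel)"
    by (rule bochner_has_integral_norm_le)
  also have "\<dots> \<le> (\<integral>\<^sup>+u. ennreal (indicator {s<..t} u *\<^sub>R g u) \<partial>lborel)"
    using st le by (intro nn_integral_mono ennreal_leI) (auto split: split_indicator)
  also have "\<dots> = ennreal (LINT u:{s<..t}|lborel. g u)"
    unfolding set_lebesgue_integral_def
    by (rule nn_integral_eq_integral)
      (use g_sub(2) g_nonneg in \<open>auto simp: set_integrable_def\<close>)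
  finally have "norm (?F t - ?F s) \<le> (LINT u:{s<..t}|lborel. g u)"
    using g_nonneg by (subst (asm) ennreal_le_iff)
      (auto simp: set_lebesgue_integral_def intro!: Bochner_Integration.integral_nonneg)
  moreover have "(LINT u:{0..s} \<union> {s<..t}|lborel. g u)
      = (LINT u:{0..s}|lborel. g u) + (LINT u:{s<..t}|lborel. g u)"
    by (rule set_integral_Un[OF _ g_sub]) auto
  moreover have "{0..s} \<union> {s<..t} = {0..t}" using st by auto
  ultimately show ?thesis by simp
qed

section \<open>Paths of the tensor covariation\<close>

abbreviation scalar_approximation where
  "scalar_approximation T X Y \<equiv> \<lambda>\<epsilon> t \<omega>. LINT s:{0..t}|lborel. scalar_integrand T X Y \<epsilon> s \<omega>"

abbreviation tensor_approximation where
  "tensor_approximation T X Y \<equiv>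
     \<lambda>\<epsilon> t \<omega>. bochner_integral lborel (\<lambda>s. indicator {0..t} s *\<^sub>R tensor_integrand T X Y \<epsilon> s \<omega>)"

text \<open>The source of all path regularity of the tensor covariation: the right-hand side is the increment
  of a limit that has continuous paths when \<open>L\<close> is the scalar covariation. Both approximations have
  to converge almost surely along the same sequence, hence the second extraction inside the first.\<close>

lemma tensor_covariation_increment_le:
  fixes X :: "real \<Rightarrow> 'w \<Rightarrow> 'a::banach" and Y :: "real \<Rightarrow> 'w \<Rightarrow> 'b::banach"
  assumes int: "covariation_integrals_exist M T X Y"
    and L: "ucp_converges M T (scalar_approximation T X Y) L"
    and Z: "ucp_converges M T (tensor_approximation T X Y) Z"
  shows "AE \<omega> in M. \<forall>s t. 0 \<le> s \<longrightarrow> s \<le> t \<longrightarrow> t \<le> T \<longrightarrow> norm (Z t \<omega> - Z s \<omega>) \<le> L t \<omega> - L s \<omega>"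
proof -
  define e where "e n = inverse (real (Suc n))" for n
  have e: "0 < e n" for n by (simp add: e_def)
  have e_lim: "e \<longlonglongrightarrow> 0" unfolding e_def by (rule LIMSEQ_inverse_real_of_nat)
  obtain r where r: "strict_mono r"
    "AE \<omega> in M. \<forall>t\<in>{0..T}. (\<lambda>k. scalar_approximation T X Y (e (r k)) t \<omega>) \<longlonglongrightarrow> L t \<omega>"
    using ucp_converges_AE_subsequence[OF L e e_lim] by blast
  have "(\<lambda>k. e (r k)) \<longlonglongrightarrow> 0" using LIMSEQ_subseq_LIMSEQ[OF e_lim r(1)] by (simp add: o_def)
  then obtain q where q: "strict_mono q"
    "AE \<omega> in M. \<forall>t\<in>{0..T}. (\<lambda>k. tensor_approximation T X Y (e (r (q k))) t \<omega>) \<longlonglongrightarrow> Z t \<omega>"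
    using ucp_converges_AE_subsequence[OF Z, of "\<lambda>k. e (r k)"] e by blast
  have "AE \<omega> in M. \<forall>n. set_integrable lborel {0..T} (\<lambda>s. scalar_integrand T X Y (e n) s \<omega>) \<and>
      bochner_integrable lborel (\<lambda>s. indicator {0..T} s *\<^sub>R tensor_integrand T X Y (e n) s \<omega>)"
    using int e unfolding covariation_integrals_exist_def AE_all_countable by blast
  then show ?thesis
    using r(2) q(2)
  proof eventually_elim
    case (elim \<omega>)
    show ?case
    proof (intro allI impI)
      fix s t assume st: "0 \<le> s" "s \<le> t" "t \<le> T"
      let ?F = "\<lambda>k u. tensor_approximation T X Y (e (r (q k))) u \<omega>"
      let ?G = "\<lambda>k u. scalar_approximation T X Y (e (r (q k))) u \<omega>"
      have F: "(\<lambda>k. ?F k u) \<longlonglongrightarrow> Z u \<omega>" if "u \<in> {0..T}" for u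
        using elim(3) that by blast
      have G: "(\<lambda>k. ?G k u) \<longlonglongrightarrow> L u \<omega>" if "u \<in> {0..T}" for u
        using LIMSEQ_subseq_LIMSEQ[OF elim(2)[rule_format, OF that] q(1)] by (simp add: o_def)
      have "norm (?F k t - ?F k s) \<le> ?G k t - ?G k s" for k
        using elim(1) st
        by (intro bochner_integral_increment_le[of T]) (auto intro: norm_tensor_integrand_le e)
      then show "norm (Z t \<omega> - Z s \<omega>) \<le> L t \<omega> - L s \<omega>"
        using st by (intro LIMSEQ_le[OF tendsto_norm[OF tendsto_diff[OF F F]] tendsto_diff[OF G G]]) auto
    qed
  qed
qed

lemma tensor_covariation_AE_paths:
  fixes X :: "real \<Rightarrow> 'w \<Rightarrow> 'a::banach" and Y :: "real \<Rightarrow> 'w \<Rightarrow> 'b::banach"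
  assumes int: "covariation_integrals_exist M T X Y"
    and scalar: "admits_scalar_covariation M T X Y"
    and Z: "is_tensor_covariation M T X Y Z"
  shows "AE \<omega> in M. continuous_on {0..T} (\<lambda>t. Z t \<omega>) \<and> bounded_variation_on T (\<lambda>t. Z t \<omega>)"
proof -
  obtain L where L: "continuous_process M T L" "ucp_converges M T (scalar_approximation T X Y) L"
    using scalar unfolding admits_scalar_covariation_def by blast
  have "ucp_converges M T (tensor_approximation T X Y) Z"
    using Z unfolding is_tensor_covariation_def by blast
  from tensor_covariation_increment_le[OF int L(2) this] AE_space show ?thesis
  proof eventually_elim
    case (elim \<omega>)
    then have "continuous_on {0..T} (\<lambda>t. L t \<omega>)"
      using L(1) unfolding continuous_process_def by blast
    then show ?case
      using elim(1) by (blast intro: dominated_increments_continuous_on[where g = "\<lambda>t. L t \<omega>"]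
          dominated_increments_bounded_variation_on[where g = "\<lambda>t. L t \<omega>"])
  qed
qed

text \<open>A tensor covariation is determined only up to a null set, whereas the processes in the global
  covariation must have continuous paths for every scenario.\<close>

lemma tensor_covariation_continuous_version:
  fixes X :: "real \<Rightarrow> 'w \<Rightarrow> 'a::banach" and Y :: "real \<Rightarrow> 'w \<Rightarrow> 'b::banach"
  assumes int: "covariation_integrals_exist M T X Y"
    and scalar: "admits_scalar_covariation M T X Y"
    and Z: "is_tensor_covariation M T X Y Z"
  shows "\<exists>Z'. is_tensor_covariation M T X Y Z' \<and>
    (\<forall>\<omega>\<in>space M. continuous_on {0..T} (\<lambda>t. Z' t \<omega>) \<and> bounded_variation_on T (\<lambda>t. Z' t \<omega>))"
proof -
  obtain N where N: "{\<omega> \<in> space M. \<not> (continuous_on {0..T} (\<lambda>t. Z t \<omega>) \<and> bounded_variation_on T (\<lambda>t. Z t \<omega>))} \<subseteq> N"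
    "emeasure M N = 0" "N \<in> sets M"
    using AE_E[OF tensor_covariation_AE_paths[OF int scalar Z]] by blast
  let ?A = "{0..T} \<times> (space M - N)"
  \<comment> \<open>Time belongs to the indicator set so that this set is measurable for the product
    \<open>\<sigma>\<close>-algebra and the product with \<open>Z\<close> is strongly measurable.\<close>
  define Z' where "Z' t \<omega> = indicator ?A (t, \<omega>) *\<^sub>R Z t \<omega>" for t \<omega>
  have Z'_eq: "Z' t \<omega> = (if \<omega> \<in> N then 0 else Z t \<omega>)" if "t \<in> {0..T}" "\<omega> \<in> space M" for t \<omega>
    using that by (auto simp: Z'_def)
  have "strongly_measurable_process M T Z'"
  proof -
    have "{0..T} \<in> sets (restrict_space borel {0..T})"
      by (auto simp: sets_restrict_space_iff)
    then have "?A \<in> sets (restrict_space borel {0..T} \<Otimes>\<^sub>M M)"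
      using N(3) by (intro pair_measureI) auto
    then have "strongly_measurable (restrict_space borel {0..T} \<Otimes>\<^sub>M M)
        (\<lambda>z. indicator ?A z *\<^sub>R (case z of (t, \<omega>) \<Rightarrow> Z t \<omega>))"
      using Z unfolding is_tensor_covariation_def strongly_measurable_process_def
      by (intro strongly_measurable_indicator) auto
    then show ?thesis
      unfolding strongly_measurable_process_def Z'_def by (simp add: case_prod_beta')
  qed
  moreover have "ucp_converges M T (tensor_approximation T X Y) Z'"
  proof (rule ucp_converges_dominated[where K = 1])
    show "ucp_converges M T (tensor_approximation T X Y) Z"
      using Z unfolding is_tensor_covariation_def by blast
    have "AE \<omega> in M. \<omega> \<notin> N" using N(2,3) by (intro AE_not_in) auto
    then show "AE \<omega> in M. \<forall>t\<in>{0..T}. norm (tensor_approximation T X Y \<epsilon> t \<omega> - Z' t \<omega>)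
        \<le> 1 * norm (tensor_approximation T X Y \<epsilon> t \<omega> - Z t \<omega>)" for \<epsilon>
      using AE_space by eventually_elim (simp add: Z'_eq)
  qed simp
  moreover have "continuous_on {0..T} (\<lambda>t. Z' t \<omega>) \<and> bounded_variation_on T (\<lambda>t. Z' t \<omega>)"
    if "\<omega> \<in> space M" for \<omega>
  proof (cases "\<omega> \<in> N")
    case True
    then have "Z' t \<omega> = 0" for t by (simp add: Z'_def)
    then show ?thesis by (auto simp: bounded_variation_on_def)
  next
    case False
    then have eq: "Z' t \<omega> = Z t \<omega>" if "t \<in> {0..T}" for t
      using Z'_eq \<open>\<omega> \<in> space M\<close> that by simp
    have "continuous_on {0..T} (\<lambda>t. Z t \<omega>)" "bounded_variation_on T (\<lambda>t. Z t \<omega>)"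
      using N(1) False that by auto
    moreover have "continuous_on {0..T} (\<lambda>t. Z' t \<omega>) \<longleftrightarrow> continuous_on {0..T} (\<lambda>t. Z t \<omega>)"
      by (rule continuous_on_cong) (simp_all only: eq)
    ultimately show ?thesis by (auto simp: eq bounded_variation_on_def)
  qed
  ultimately show ?thesis unfolding is_tensor_covariation_def by blast
qed

section \<open>The global covariation\<close>

text \<open>Along a subsequence the scalar integrals converge almost surely, hence are almost surely bounded,
  and they dominate the integrals in (H1).\<close>

lemma scalar_covariation_global_H1:
  fixes X :: "real \<Rightarrow> 'w \<Rightarrow> 'a::banach" and Y :: "real \<Rightarrow> 'w \<Rightarrow> 'b::banach"
  assumes "0 \<le> T" and int: "covariation_integrals_exist M T X Y"
    and scalar: "admits_scalar_covariation M T X Y"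
  shows "global_H1 M T X Y"
  unfolding global_H1_def
proof (intro allI impI, elim conjE)
  fix e :: "nat \<Rightarrow> real" assume e: "\<forall>n. 0 < e n" "e \<longlonglongrightarrow> 0"
  obtain L where L: "ucp_converges M T (scalar_approximation T X Y) L"
    using scalar unfolding admits_scalar_covariation_def by blast
  obtain r where r: "strict_mono r"
    "AE \<omega> in M. \<forall>t\<in>{0..T}. (\<lambda>k. scalar_approximation T X Y (e (r k)) t \<omega>) \<longlonglongrightarrow> L t \<omega>"
    using ucp_converges_AE_subsequence[OF L, of e] e by blast
  have "AE \<omega> in M. \<forall>n. set_integrable lborel {0..T} (\<lambda>s. scalar_integrand T X Y (e n) s \<omega>)"
    unfolding AE_all_countable
  proof
    fix n
    have "0 < e n" using e(1) by blast
    with int show "AE \<omega> in M. set_integrable lborel {0..T} (\<lambda>s. scalar_integrand T X Y (e n) s \<omega>)"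
      unfolding covariation_integrals_exist_def by (auto elim: eventually_mono)
  qed
  then have "AE \<omega> in M. (SUP k. \<integral>\<^sup>+s\<in>{0..T}. ennreal (norm (canonical_embedding
      (increment T X (e (r k)) s \<omega> \<otimes>\<^sub>\<pi> increment T Y (e (r k)) s \<omega>)) / e (r k)) \<partial>lborel) < \<infinity>"
    using r(2)
  proof eventually_elim
    case (elim \<omega>)
    let ?G = "\<lambda>k. scalar_approximation T X Y (e (r k)) T \<omega>"
    have "?G \<longlonglongrightarrow> L T \<omega>" using elim(2) \<open>0 \<le> T\<close> by auto
    then have "Bseq ?G" by (intro convergent_imp_Bseq convergentI)
    then obtain K where K: "\<And>k. norm (?G k) \<le> K" unfolding Bseq_def by blast
    have "(\<integral>\<^sup>+s\<in>{0..T}. ennreal (norm (canonical_embedding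
        (increment T X (e (r k)) s \<omega> \<otimes>\<^sub>\<pi> increment T Y (e (r k)) s \<omega>)) / e (r k)) \<partial>lborel) \<le> ennreal K" for k
    proof -
      have e_pos: "0 < e (r k)" using e(1) by blast
      have le: "norm (canonical_embedding (increment T X (e (r k)) s \<omega> \<otimes>\<^sub>\<pi> increment T Y (e (r k)) s \<omega>)) / e (r k)
          \<le> scalar_integrand T X Y (e (r k)) s \<omega>" for s
        unfolding scalar_integrand_def using e_pos
        by (intro divide_right_mono order_trans[OF norm_canonical_embedding_le norm_tensor_le]) auto
      have "(\<integral>\<^sup>+s\<in>{0..T}. ennreal (norm (canonical_embedding
          (increment T X (e (r k)) s \<omega> \<otimes>\<^sub>\<pi> increment T Y (e (r k)) s \<omega>)) / e (r k)) \<partial>lborel)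
        \<le> (\<integral>\<^sup>+s. ennreal (indicator {0..T} s *\<^sub>R scalar_integrand T X Y (e (r k)) s \<omega>) \<partial>lborel)"
        using le by (intro nn_integral_mono) (auto intro: ennreal_leI split: split_indicator)
      also have "\<dots> = ennreal (?G k)"
        unfolding set_lebesgue_integral_def
        by (rule nn_integral_eq_integral)
          (use elim(1) e_pos in \<open>auto simp: set_integrable_def scalar_integrand_def\<close>)
      also have "\<dots> \<le> ennreal K" using K[of k] by (intro ennreal_leI) auto
      finally show ?thesis .
    qed
    then show ?case by (intro le_less_trans[OF SUP_least, of UNIV _ "ennreal K"]) auto
  qed
  with r(1) show "\<exists>r :: nat \<Rightarrow> nat. strict_mono r \<and> (AE \<omega> in M. (SUP k. \<integral>\<^sup>+s\<in>{0..T}. ennreal (norm (canonical_embedding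
      (increment T X (e (r k)) s \<omega> \<otimes>\<^sub>\<pi> increment T Y (e (r k)) s \<omega>)) / e (r k)) \<partial>lborel) < \<infinity>)"
    by blast
qed

lemma tensor_covariation_ucp_dual:
  fixes X :: "real \<Rightarrow> 'w \<Rightarrow> 'a::banach" and Y :: "real \<Rightarrow> 'w \<Rightarrow> 'b::banach"
    and \<phi> :: "('a, 'b) tensor_dual"
  assumes int: "covariation_integrals_exist M T X Y"
    and Z: "is_tensor_covariation M T X Y Z"
  shows "ucp_converges M T
    (\<lambda>\<epsilon> t \<omega>. LINT s:{0..t}|lborel. blinfun_apply \<phi> (tensor_integrand T X Y \<epsilon> s \<omega>))
    (\<lambda>t \<omega>. blinfun_apply \<phi> (Z t \<omega>))"
proof (rule ucp_converges_dominated[where K = "norm \<phi>"])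
  show "ucp_converges M T (tensor_approximation T X Y) Z"
    using Z unfolding is_tensor_covariation_def by blast
  fix \<epsilon> :: real assume "\<epsilon> > 0"
  then have "AE \<omega> in M. bochner_integrable lborel (\<lambda>s. indicator {0..T} s *\<^sub>R tensor_integrand T X Y \<epsilon> s \<omega>)"
    using int unfolding covariation_integrals_exist_def by auto
  then show "AE \<omega> in M. \<forall>t\<in>{0..T}.
      norm ((LINT s:{0..t}|lborel. blinfun_apply \<phi> (tensor_integrand T X Y \<epsilon> s \<omega>)) - blinfun_apply \<phi> (Z t \<omega>))
      \<le> norm \<phi> * norm (tensor_approximation T X Y \<epsilon> t \<omega> - Z t \<omega>)"
  proof eventually_elim
    case (elim \<omega>)
    show ?case
    proof
      fix t assume t: "t \<in> {0..T}"
      have "bochner_has_integral lborel (\<lambda>s. indicator {0..t} s *\<^sub>R tensor_integrand T X Y \<epsilon> s \<omega>)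
          (tensor_approximation T X Y \<epsilon> t \<omega>)"
        using t by (intro bochner_integrable_has_integral bochner_integrable_initial_segment[OF elim]) auto
      from bochner_has_integral_blinfun[OF this, of \<phi>] have "has_bochner_integral lborel
          (\<lambda>s. indicator {0..t} s *\<^sub>R blinfun_apply \<phi> (tensor_integrand T X Y \<epsilon> s \<omega>))
          (blinfun_apply \<phi> (tensor_approximation T X Y \<epsilon> t \<omega>))"
        by (simp add: blinfun.scaleR_right)
      then have "(LINT s:{0..t}|lborel. blinfun_apply \<phi> (tensor_integrand T X Y \<epsilon> s \<omega>))
          = blinfun_apply \<phi> (tensor_approximation T X Y \<epsilon> t \<omega>)"
        unfolding set_lebesgue_integral_def by (rule has_bochner_integral_integral_eq)
      then show "norm ((LINT s:{0..t}|lborel. blinfun_apply \<phi> (tensor_integrand T X Y \<epsilon> s \<omega>)) - blinfun_apply \<phi> (Z t \<omega>))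
          \<le> norm \<phi> * norm (tensor_approximation T X Y \<epsilon> t \<omega> - Z t \<omega>)"
        using norm_blinfun[of \<phi> "tensor_approximation T X Y \<epsilon> t \<omega> - Z t \<omega>"]
        by (simp add: blinfun.diff_right)
    qed
  qed
qed simp

lemma continuous_tensor_covariation_is_global_covariation:
  fixes X :: "real \<Rightarrow> 'w \<Rightarrow> 'a::banach" and Y :: "real \<Rightarrow> 'w \<Rightarrow> 'b::banach"
  assumes "0 \<le> T" and int: "covariation_integrals_exist M T X Y"
    and scalar: "admits_scalar_covariation M T X Y"
    and Z: "is_tensor_covariation M T X Y Z"
    and paths: "\<And>\<omega>. \<omega> \<in> space M \<Longrightarrow> continuous_on {0..T} (\<lambda>t. Z t \<omega>) \<and> bounded_variation_on T (\<lambda>t. Z t \<omega>)"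
  shows "is_global_covariation M T X Y (\<lambda>t \<omega>. canonical_embedding (Z t \<omega>))"
proof -
  let ?Q = "\<lambda>\<phi> t \<omega>. blinfun_apply \<phi> (Z t \<omega>)" and ?W = "\<lambda>t \<omega>. canonical_embedding (Z t \<omega>)"
  have sm: "strongly_measurable (restrict_space borel {0..T} \<Otimes>\<^sub>M M) (\<lambda>(t, \<omega>). Z t \<omega>)"
    using Z unfolding is_tensor_covariation_def strongly_measurable_process_def by blast
  have "continuous_process M T (?Q \<phi>)" for \<phi>
  proof -
    have "(\<lambda>z. blinfun_apply \<phi> (case z of (t, \<omega>) \<Rightarrow> Z t \<omega>)) \<in> borel_measurable (restrict_space borel {0..T} \<Otimes>\<^sub>M M)"
      by (intro strongly_measurable_imp_borel_measurable
          strongly_measurable_compose[OF sm, of "blinfun_apply \<phi>"]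
          linear_continuous_on blinfun.bounded_linear_right)
    then show ?thesis
      using paths unfolding continuous_process_def measurable_process_def
      by (auto simp: case_prod_beta' intro!: continuous_intros)
  qed
  then have H2i: "global_H2i M T X Y ?Q"
    unfolding global_H2i_def using tensor_covariation_ucp_dual[OF int Z] by blast
  have "strongly_measurable_process M T ?W"
    using strongly_measurable_compose[OF sm linear_continuous_on[OF bounded_linear_canonical_embedding]]
    unfolding strongly_measurable_process_def by (simp add: case_prod_beta')
  moreover have "AE \<omega> in M. cadlag_on T (\<lambda>t. ?W t \<omega>) \<and> bounded_variation_on T (\<lambda>t. ?W t \<omega>)"
    using AE_space
  proof eventually_elim
    case (elim \<omega>)
    have "continuous_on {0..T} (\<lambda>t. ?W t \<omega>)"
      using paths[OF elim] by (intro bounded_linear.continuous_on[OF bounded_linear_canonical_embedding]) auto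
    moreover have "bounded_variation_on T (\<lambda>t. ?W t \<omega>)"
    proof -
      obtain C where C: "\<And>n p. (\<forall>i<n. p i \<le> p (Suc i)) \<Longrightarrow> (\<forall>i\<le>n. p i \<in> {0..T}) \<Longrightarrow>
          (\<Sum>i<n. norm (Z (p (Suc i)) \<omega> - Z (p i) \<omega>)) \<le> C"
        using paths[OF elim] unfolding bounded_variation_on_def by blast
      have "norm (?W t \<omega> - ?W s \<omega>) \<le> norm (Z t \<omega> - Z s \<omega>)" for s t
        using norm_canonical_embedding_le[of "Z t \<omega> - Z s \<omega>"]
        by (simp add: bounded_linear.linear[OF bounded_linear_canonical_embedding] linear_diff)
      then have "(\<Sum>i<n. norm (?W (p (Suc i)) \<omega> - ?W (p i) \<omega>))
          \<le> (\<Sum>i<n. norm (Z (p (Suc i)) \<omega> - Z (p i) \<omega>))" for n and p :: "nat \<Rightarrow> real"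
        by (intro sum_mono)
      then show ?thesis unfolding bounded_variation_on_def using C order_trans by meson
    qed
    ultimately show ?case using continuous_on_Icc_cadlag_on by blast
  qed
  ultimately have "global_H2ii M T ?Q ?W"
    unfolding global_H2ii_def by (simp add: canonical_embedding_apply)
  with H2i scalar_covariation_global_H1[OF assms(1-3)] show ?thesis
    unfolding is_global_covariation_def by blast
qed

text \<open>Testing against a single \<open>\<phi>\<close> at a single time gives only null sets depending on both. The
  dependence on \<open>\<phi>\<close> is removed first, at a fixed time, by strong measurability; the dependence on time
  second, by right continuity of both paths.\<close>

lemma global_covariation_AE_eq_tensor_covariation:
  fixes X :: "real \<Rightarrow> 'w \<Rightarrow> 'a::banach" and Y :: "real \<Rightarrow> 'w \<Rightarrow> 'b::banach"
  assumes int: "covariation_integrals_exist M T X Y"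
    and scalar: "admits_scalar_covariation M T X Y"
    and W: "is_global_covariation M T X Y W"
    and Z: "is_tensor_covariation M T X Y Z"
  shows "AE \<omega> in M. \<forall>t\<in>{0..T}. W t \<omega> = canonical_embedding (Z t \<omega>)"
proof -
  obtain Q where Q: "global_H2i M T X Y Q" "global_H2ii M T Q W"
    using W unfolding is_global_covariation_def by blast
  have Q_eq: "AE \<omega> in M. \<forall>t\<in>{0..T}. Q \<phi> t \<omega> = blinfun_apply \<phi> (Z t \<omega>)" for \<phi>
  proof (rule ucp_converges_unique[OF _ tensor_covariation_ucp_dual[OF int Z]])
    show "ucp_converges M T
        (\<lambda>\<epsilon> t \<omega>. LINT s:{0..t}|lborel. blinfun_apply \<phi> (tensor_integrand T X Y \<epsilon> s \<omega>)) (Q \<phi>)"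
      using Q(1) unfolding global_H2i_def by blast
  qed
  have fixed_time: "AE \<omega> in M. W t \<omega> = canonical_embedding (Z t \<omega>)" if t: "t \<in> {0..T}" for t
  proof -
    have space: "t \<in> space (restrict_space borel {0..T})"
      using t by (simp add: space_restrict_space)
    have "strongly_measurable M (W t)"
      using Q(2) strongly_measurable_section[OF _ space]
      unfolding global_H2ii_def strongly_measurable_process_def by blast
    moreover have "strongly_measurable M (Z t)"
      using Z strongly_measurable_section[OF _ space]
      unfolding is_tensor_covariation_def strongly_measurable_process_def by blast
    ultimately have "strongly_measurable M (\<lambda>\<omega>. W t \<omega> - canonical_embedding (Z t \<omega>))"
      by (intro strongly_measurable_diff strongly_measurable_compose[of M "Z t" canonical_embedding]
          linear_continuous_on bounded_linear_canonical_embedding)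
    moreover have "AE \<omega> in M. blinfun_apply (W t \<omega> - canonical_embedding (Z t \<omega>)) \<phi> = 0" for \<phi>
    proof -
      have "AE \<omega> in M. blinfun_apply (W t \<omega>) \<phi> = Q \<phi> t \<omega>"
        using Q(2) t unfolding global_H2ii_def by blast
      then show ?thesis
        using Q_eq[of \<phi>]
        by eventually_elim (use t in \<open>auto simp: blinfun.diff_left canonical_embedding_apply\<close>)
    qed
    ultimately have "AE \<omega> in M. W t \<omega> - canonical_embedding (Z t \<omega>) = 0"
      by (rule strongly_measurable_dual_AE_zero)
    then show ?thesis by simp
  qed
  have "countable ((\<rat> \<union> {T}) \<inter> {0..T})" by (simp add: countable_rat)
  then have "AE \<omega> in M. \<forall>t\<in>(\<rat> \<union> {T}) \<inter> {0..T}. W t \<omega> = canonical_embedding (Z t \<omega>)"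
    using fixed_time by (subst AE_ball_countable) auto
  moreover have "AE \<omega> in M. cadlag_on T (\<lambda>t. W t \<omega>)"
    using Q(2) unfolding global_H2ii_def by (auto elim: eventually_mono)
  ultimately show ?thesis
    using tensor_covariation_AE_paths[OF int scalar Z]
  proof eventually_elim
    case (elim \<omega>)
    have "cadlag_on T (\<lambda>t. canonical_embedding (Z t \<omega>))"
      using elim(3)
      by (intro continuous_on_Icc_cadlag_on bounded_linear.continuous_on[OF bounded_linear_canonical_embedding]) auto
    show ?case
    proof
      fix t assume "t \<in> {0..T}"
      then show "W t \<omega> = canonical_embedding (Z t \<omega>)"
        by (rule right_continuous_eqI[where f = "\<lambda>t. W t \<omega>", rotated 3])
          (use elim(1,2) \<open>cadlag_on T (\<lambda>t. canonical_embedding (Z t \<omega>))\<close> in \<open>auto simp: cadlag_on_def\<close>)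
    qed
  qed
qed

theorem proposition3p15:
  fixes M :: "'w measure" and T :: real
    and X :: "real \<Rightarrow> 'w \<Rightarrow> 'a::banach"
    and Y :: "real \<Rightarrow> 'w \<Rightarrow> 'b::banach"
  assumes "prob_space M" and "T > 0"
    and "measurable_process M T X" and "measurable_process M T Y"
    and "covariation_integrals_exist M T X Y"
    and "admits_scalar_covariation M T X Y"
    and "admits_tensor_covariation M T X Y"
  shows "admits_global_covariation M T X Y \<and>
    (\<forall>W Z. is_global_covariation M T X Y W \<and> is_tensor_covariation M T X Y Z \<longrightarrow>
       (AE \<omega> in M. \<forall>t\<in>{0..T}. W t \<omega> \<in> range canonical_embedding) \<and>
       (AE \<omega> in M. \<forall>t\<in>{0..T}. W t \<omega> = canonical_embedding (Z t \<omega>)))"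
proof (intro conjI allI impI)
  have T: "0 \<le> T" using \<open>T > 0\<close> by simp
  note int = \<open>covariation_integrals_exist M T X Y\<close>
  note scalar = \<open>admits_scalar_covariation M T X Y\<close>
  obtain Z where "is_tensor_covariation M T X Y Z"
    using assms(7) unfolding admits_tensor_covariation_def by blast
  then obtain Z' where Z': "is_tensor_covariation M T X Y Z'"
    "\<And>\<omega>. \<omega> \<in> space M \<Longrightarrow> continuous_on {0..T} (\<lambda>t. Z' t \<omega>) \<and> bounded_variation_on T (\<lambda>t. Z' t \<omega>)"
    using tensor_covariation_continuous_version[OF int scalar] by blast
  show "admits_global_covariation M T X Y"
    unfolding admits_global_covariation_def
    using continuous_tensor_covariation_is_global_covariation[OF T int scalar Z'] by blast
  fix W Z assume WZ: "is_global_covariation M T X Y W \<and> is_tensor_covariation M T X Y Z"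
  then show *: "AE \<omega> in M. \<forall>t\<in>{0..T}. W t \<omega> = canonical_embedding (Z t \<omega>)"
    using global_covariation_AE_eq_tensor_covariation[OF int scalar] by blast
  then show "AE \<omega> in M. \<forall>t\<in>{0..T}. W t \<omega> \<in> range canonical_embedding"
    by eventually_elim auto
qed

end
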